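(* There exist absolute constants $C_0>0$ and $\varepsilon_0>0$ such that the following holds for every positive integer $n$. Let $U$ be the linear span of the indicator functions of stars in $\mathcal{M}_n$, and let $A$ be any set of perfect matchings of $\mathcal{K}_{2n}$ of size $c(2n-3)!!$, where $c\leq\frac{2n-1}{2}$. If $0\le \varepsilon\leq\varepsilon_0$ and $$\|\mathbf{1}_A-\operatorname{Proj}_U(\mathbf{1}_A)\|^2\leq \varepsilon\,\frac{c}{2n-1},$$ then there is a set $B$ that is a union of $\mathrm{round}(c)$ stars in $\mathcal{M}_n$ such that $$|A\,\Delta\, B|\leq C_0c^2(2n-3)!!\left(\sqrt{\varepsilon}+\frac{1}{2n-1}\right).$$ Moreover $|c-\mathrm{round}(c)|\leq C_0c^2\left(\sqrt{\varepsilon}+\frac{1}{2n-1}\right)$.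
   Context: $\mathcal{M}_n$ denotes the perfect matching graph, whose vertex set $V$ is the set of all $(2n-1)!!$ perfect matchings of the complete graph $\mathcal{K}_{2n}$ (matchings adjacent iff they have no common edge). For an edge $\mathsf{e}$ of $\mathcal{K}_{2n}$, the star $\mathcal{S}_{\mathsf{e}}$ is the set of all perfect matchings containing $\mathsf{e}$. $\mathbf{1}_A\in\mathbb{R}[V]$ (the real-valued functions on $V$) is the $0/1$ indicator function of $A$. The norm on $\mathbb{R}[V]$ is $\|f\|=\left(\frac{1}{|V|}\sum_{v\in V}f(v)^2\right)^{1/2}$, and $\operatorname{Proj}_U$ is the orthogonal projection onto $U$. $\mathrm{round}(c)$ is the integer closest to $c$ (rounding up in case of a tie). $\Delta$ is symmetric difference. $(2m-1)!!=(2m-1)(2m-3)\cdots1$, with $(-1)!!=1$. *)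

theory Defs
  imports Complex_Main "HOL-Library.Indicator_Function" "HOL-Library.Function_Algebras"
begin

text \<open>The complete graph on \<open>2 * n\<close> vertices has vertex set \<open>{..<2 * n}\<close>; edges are two-element sets.\<close>

definition K_edges :: "nat \<Rightarrow> nat set set" where
  "K_edges n = {e. e \<subseteq> {..<2 * n} \<and> card e = 2}"

definition perfect_matchings :: "nat \<Rightarrow> nat set set set" where
  "perfect_matchings n = {M. M \<subseteq> K_edges n \<and> (\<forall>v\<in>{..<2 * n}. \<exists>!e. e \<in> M \<and> v \<in> e)}"

definition star :: "nat \<Rightarrow> nat set \<Rightarrow> nat set set set" where
  "star n e = {M \<in> perfect_matchings n. e \<in> M}"

definition stars :: "nat \<Rightarrow> nat set set set set" where
  "stars n = star n ` K_edges n"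

text \<open>\<open>odd_dfact m\<close> is \<open>(2m - 1)!!\<close>, so \<open>(-1)!! = 1\<close> is \<open>odd_dfact 0\<close>.\<close>

definition odd_dfact :: "nat \<Rightarrow> nat" where
  "odd_dfact m = (\<Prod>i<m. 2 * i + 1)"

text \<open>
  Real-valued functions on the set \<open>V\<close> of perfect matchings are represented by total functions
  on \<open>nat set set\<close> that vanish outside \<open>V\<close>. The inner product and norm only see values on \<open>V\<close>.
\<close>

definition fun_scale :: "real \<Rightarrow> ('a \<Rightarrow> real) \<Rightarrow> 'a \<Rightarrow> real" where
  "fun_scale a f = (\<lambda>x. a * f x)"

lemma vector_space_fun_scale: "vector_space fun_scale"
  by unfold_locales (auto simp: fun_scale_def fun_eq_iff algebra_simps)

definition pm_inner :: "nat \<Rightarrow> (nat set set \<Rightarrow> real) \<Rightarrow> (nat set set \<Rightarrow> real) \<Rightarrow> real" where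
  "pm_inner n f g =
     1 / real (card (perfect_matchings n)) * (\<Sum>v\<in>perfect_matchings n. f v * g v)"

definition pm_norm :: "nat \<Rightarrow> (nat set set \<Rightarrow> real) \<Rightarrow> real" where
  "pm_norm n f =
     sqrt (1 / real (card (perfect_matchings n)) * (\<Sum>v\<in>perfect_matchings n. (f v)\<^sup>2))"

definition star_span :: "nat \<Rightarrow> (nat set set \<Rightarrow> real) set" where
  "star_span n = module.span fun_scale (indicator ` stars n)"

text \<open>
  For a linear subspace \<open>U\<close> of functions vanishing outside the perfect matchings (such as
  \<open>star_span n\<close>) the description below determines the projection uniquely.
\<close>

definition Proj :: "nat \<Rightarrow> (nat set set \<Rightarrow> real) set \<Rightarrow> (nat set set \<Rightarrow> real) \<Rightarrow> nat set set \<Rightarrow> real" where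
  "Proj n U f = (THE g. g \<in> U \<and> (\<forall>h\<in>U. pm_inner n (f - g) h = 0))"

end

theory Submission
  imports Defs "HOL-Analysis.Convex"
begin

text \<open>
  Write \<open>N = 2n - 1\<close> and normalise the densities of \<open>A\<close> on stars to
  \<open>b e = |A \<inter> S\<^sub>e| / (2n - 3)!!\<close>. The function \<open>x e = b e - c / N\<close> has zero sum over the edges at
  each vertex, and \<open>Proj\<^sub>U 1\<^sub>A\<close> is \<open>F = c / N + (N - 2) / (N - 1) * g\<close> with \<open>g M = \<Sum>e\<in>M. x e\<close>.
  Comparing second moments gives \<open>\<Sum>x\<^sup>2 \<lesssim> c\<close>. For the third moment put \<open>h = 1\<^sub>A - F\<close>: since
  \<open>F \<ge> -c\<close>, pointwise \<open>F\<^sup>3 \<ge> 1\<^sub>A (1 - 3h) - c h\<^sup>2\<close>, and \<open>E[1\<^sub>A h] = E[h\<^sup>2]\<close>, so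
  \<open>E[F\<^sup>3] \<ge> (1 - (3 + c)\<epsilon>) c / N\<close>. As the zero row sums make all off-diagonal contributions to
  \<open>E[g\<^sup>3]\<close> small, this forces \<open>\<Sum>x\<^sup>2 b \<gtrsim> c\<close>. Hence \<open>\<Sum>x\<^sup>2 (1 - b)\<close> is small, i.e. about \<open>c\<close> edges
  have \<open>b\<close> close to 1, and the stars of these edges approximate \<open>A\<close>.
\<close>

section \<open>Moments of edge weights over perfect matchings\<close>

text \<open>Arbitrary vertex sets replace \<open>{..<2 * n}\<close> because deleting the endpoints
  of an edge must leave a problem of the same kind; the counts and moments below rest on such
  deletions.\<close>

definition edges_on :: "'a set \<Rightarrow> 'a set set" where
  "edges_on W = {e. e \<subseteq> W \<and> card e = 2}"

definition pm_on :: "'a set \<Rightarrow> 'a set set set" where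
  "pm_on W = {M. M \<subseteq> edges_on W \<and> (\<forall>v\<in>W. \<exists>!e. e \<in> M \<and> v \<in> e)}"

lemma K_edges_eq_edges_on: "K_edges n = edges_on {..<2 * n}"
  by (simp add: K_edges_def edges_on_def)

lemma perfect_matchings_eq_pm_on: "perfect_matchings n = pm_on {..<2 * n}"
  by (simp add: perfect_matchings_def pm_on_def K_edges_eq_edges_on)

lemma finite_edges_on: "finite W \<Longrightarrow> finite (edges_on W)"
  by (rule finite_subset[of _ "Pow W"]) (auto simp: edges_on_def)

lemma finite_pm_on: "finite W \<Longrightarrow> finite (pm_on W)"
  by (rule finite_subset[of _ "Pow (edges_on W)"]) (auto simp: pm_on_def finite_edges_on)

lemma pm_on_subset: "M \<in> pm_on W \<Longrightarrow> M \<subseteq> edges_on W"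
  by (simp add: pm_on_def)

lemma finite_pm_on_member: "finite W \<Longrightarrow> M \<in> pm_on W \<Longrightarrow> finite M"
  using finite_edges_on finite_subset pm_on_subset by metis

section \<open>Disjoint edges, deletion of an edge, and the number of perfect matchings\<close>

lemma pm_on_disjoint:
  assumes "M \<in> pm_on W" "e \<in> M" "f \<in> M" "e \<noteq> f"
  shows "e \<inter> f = {}"
proof (rule ccontr)
  assume "e \<inter> f \<noteq> {}"
  then obtain v where v: "v \<in> e" "v \<in> f" by auto
  with assms have "v \<in> W" by (auto simp: pm_on_def edges_on_def)
  with assms v show False by (auto simp: pm_on_def)
qed

lemma pm_on_unique_edge:
  assumes "M \<in> pm_on W" "v \<in> W"
  shows "card {e \<in> M. v \<in> e} = 1"
proof -
  have "\<exists>!e. e \<in> M \<and> v \<in> e" using assms by (auto simp: pm_on_def)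
  then obtain e where "{e \<in> M. v \<in> e} = {e}" by auto
  then show ?thesis by simp
qed

text \<open>Removing \<open>e\<close> from a matching that contains it leaves a perfect matching of
  the vertices outside \<open>e\<close>, and adding it back reverses this. This is the recursion
  behind the counts and moments.\<close>

lemma bij_betw_pm_on_insert:
  assumes "e \<in> edges_on W"
  shows "bij_betw (insert e) (pm_on (W - e)) {M \<in> pm_on W. e \<in> M}"
proof (rule bij_betwI[where g = "\<lambda>M. M - {e}"])
  have ne: "e \<noteq> {}" and eW: "e \<subseteq> W" using assms by (auto simp: edges_on_def)
  show "insert e \<in> pm_on (W - e) \<rightarrow> {M \<in> pm_on W. e \<in> M}"
  proof
    fix M assume M: "M \<in> pm_on (W - e)"
    have disj: "f \<inter> e = {}" if "f \<in> M" for f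
      using M that by (auto simp: pm_on_def edges_on_def)
    have "\<exists>!f. f \<in> insert e M \<and> v \<in> f" if "v \<in> W" for v
    proof (cases "v \<in> e")
      case True
      then show ?thesis using disj by blast
    next
      case False
      with that M have "\<exists>!f. f \<in> M \<and> v \<in> f" by (auto simp: pm_on_def)
      then show ?thesis using False by blast
    qed
    then show "insert e M \<in> {M \<in> pm_on W. e \<in> M}"
      using M assms by (auto simp: pm_on_def edges_on_def)
  qed
  show "(\<lambda>M. M - {e}) \<in> {M \<in> pm_on W. e \<in> M} \<rightarrow> pm_on (W - e)"
  proof
    fix M assume "M \<in> {M \<in> pm_on W. e \<in> M}"
    then have M: "M \<in> pm_on W" "e \<in> M" by auto
    have "f \<in> edges_on (W - e)" if "f \<in> M - {e}" for f
      using pm_on_disjoint[OF M(1) M(2), of f] that pm_on_subset[OF M(1)]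
      by (auto simp: edges_on_def)
    moreover have "\<exists>!f. f \<in> M - {e} \<and> v \<in> f" if "v \<in> W - e" for v
    proof -
      have "\<exists>!f. f \<in> M \<and> v \<in> f" using M(1) that by (auto simp: pm_on_def)
      then show ?thesis using that by blast
    qed
    ultimately show "M - {e} \<in> pm_on (W - e)" by (auto simp: pm_on_def)
  qed
  show "insert e M - {e} = M" if "M \<in> pm_on (W - e)" for M
    using that ne by (auto simp: pm_on_def edges_on_def)
  show "insert e (M - {e}) = M" if "M \<in> {M \<in> pm_on W. e \<in> M}" for M
    using that by auto
qed

lemma edge_notin_pm_on:
  assumes "e \<in> edges_on W" "M \<in> pm_on (W - e)"
  shows "e \<notin> M"
proof
  assume "e \<in> M"
  then have "e \<subseteq> W - e" using pm_on_subset[OF assms(2)] by (auto simp: edges_on_def)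
  then have "e = {}" by auto
  with assms(1) show False by (simp add: edges_on_def)
qed

lemma sum_pm_on_containing:
  assumes "e \<in> edges_on W"
  shows "(\<Sum>M | M \<in> pm_on W \<and> e \<in> M. \<phi> M) = (\<Sum>M\<in>pm_on (W - e). \<phi> (insert e M))"
  using sum.reindex_bij_betw[OF bij_betw_pm_on_insert[OF assms], of \<phi>] by simp

text \<open>Double counting of the pairs of a matching and one of its edges, followed by deletion of
  that edge. Each use expands one factor of a power of \<open>sum x M\<close>.\<close>

lemma sum_pm_on_edges:
  assumes "finite W"
  shows "(\<Sum>M\<in>pm_on W. \<Sum>e\<in>M. \<phi> e M) =
    (\<Sum>e\<in>edges_on W. \<Sum>M\<in>pm_on (W - e). \<phi> e (insert e M))"
proof -
  have "(\<Sum>M\<in>pm_on W. \<Sum>e\<in>M. \<phi> e M) = (\<Sum>M\<in>pm_on W. \<Sum>e | e \<in> edges_on W \<and> e \<in> M. \<phi> e M)"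
  proof (intro sum.cong refl)
    fix M assume "M \<in> pm_on W"
    then show "M = {e. e \<in> edges_on W \<and> e \<in> M}" using pm_on_subset by blast
  qed
  also have "\<dots> = (\<Sum>e\<in>edges_on W. \<Sum>M | M \<in> pm_on W \<and> e \<in> M. \<phi> e M)"
    using finite_pm_on[OF assms] finite_edges_on[OF assms] by (rule sum.swap_restrict)
  also have "\<dots> = (\<Sum>e\<in>edges_on W. \<Sum>M\<in>pm_on (W - e). \<phi> e (insert e M))"
    by (intro sum.cong refl sum_pm_on_containing)
  finally show ?thesis .
qed

lemma card_edges_on_diff:
  assumes "finite W" "e \<in> edges_on W" "card W = 2 * Suc k"
  shows "card (W - e) = 2 * k"
proof -
  have "finite e" "e \<subseteq> W" "card e = 2"
    using assms finite_subset by (auto simp: edges_on_def)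
  then show ?thesis using assms(3) by (simp add: card_Diff_subset)
qed

lemma odd_dfact_Suc: "odd_dfact (Suc k) = odd_dfact k * (2 * k + 1)"
  by (simp add: odd_dfact_def)

lemma odd_dfact_pos: "odd_dfact k > 0"
  by (simp add: odd_dfact_def prod_pos)

text \<open>In the induction step the partner \<open>u\<close> of a fixed vertex \<open>v\<close>
  can be chosen in \<open>2 * k + 1\<close> ways, and the rest is a perfect matching of the other
  \<open>2 * k\<close> vertices.\<close>

lemma card_pm_on:
  assumes "finite W" "card W = 2 * k"
  shows "card (pm_on W) = odd_dfact k"
  using assms
proof (induction k arbitrary: W)
  case 0
  then have "pm_on W = {{}}" by (auto simp: pm_on_def edges_on_def)
  then show ?case by (simp add: odd_dfact_def)
next
  case (Suc k)
  then obtain v where v: "v \<in> W" by fastforce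
  let ?F = "\<lambda>u. {M \<in> pm_on W. {v, u} \<in> M}"
  have edge: "{v, u} \<in> edges_on W" if "u \<in> W - {v}" for u
    using that v by (auto simp: edges_on_def)
  have cover: "pm_on W = (\<Union>u\<in>W - {v}. ?F u)"
  proof (intro equalityI subsetI)
    fix M assume M: "M \<in> pm_on W"
    then obtain e where e: "e \<in> M" "v \<in> e" using v by (auto simp: pm_on_def)
    then have "card e = 2" "e \<subseteq> W" using pm_on_subset[OF M] by (auto simp: edges_on_def)
    then obtain u where "e = {v, u}" "u \<noteq> v"
      using e(2) by (auto simp: card_2_iff)
    then show "M \<in> (\<Union>u\<in>W - {v}. ?F u)" using M e \<open>e \<subseteq> W\<close> by auto
  qed auto
  have "card (pm_on W) = (\<Sum>u\<in>W - {v}. card (?F u))"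
    unfolding cover[symmetric]
  proof (subst cover, rule card_UN_disjoint)
    show "finite (W - {v})" using Suc.prems by simp
    show "\<forall>u\<in>W - {v}. finite (?F u)" using finite_pm_on[OF Suc.prems(1)] by simp
    show "\<forall>u\<in>W - {v}. \<forall>w\<in>W - {v}. u \<noteq> w \<longrightarrow> ?F u \<inter> ?F w = {}"
    proof (intro ballI impI)
      fix u w assume "u \<in> W - {v}" "w \<in> W - {v}" "u \<noteq> w"
      then have "{v, u} \<noteq> {v, w}" "{v, u} \<inter> {v, w} \<noteq> {}" by (auto simp: doubleton_eq_iff)
      then show "?F u \<inter> ?F w = {}" using pm_on_disjoint[of _ W "{v, u}" "{v, w}"] by auto
    qed
  qed
  also have "\<dots> = (\<Sum>u\<in>W - {v}. odd_dfact k)"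
  proof (intro sum.cong refl)
    fix u assume "u \<in> W - {v}"
    note e = edge[OF this]
    have "card (?F u) = card (pm_on (W - {v, u}))"
      using bij_betw_same_card[OF bij_betw_pm_on_insert[OF e]] by simp
    also have "\<dots> = odd_dfact k"
      using card_edges_on_diff[OF Suc.prems(1) e Suc.prems(2)] Suc.prems(1) Suc.IH by simp
    finally show "card (?F u) = odd_dfact k" .
  qed
  also have "\<dots> = odd_dfact (Suc k)"
    using Suc.prems v by (simp add: odd_dfact_Suc algebra_simps)
  finally show ?case .
qed

lemma card_pm_on_containing:
  assumes "finite W" "card W = 2 * Suc k" "e \<in> edges_on W"
  shows "card {M \<in> pm_on W. e \<in> M} = odd_dfact k"
  using bij_betw_same_card[OF bij_betw_pm_on_insert[OF assms(3)]]
    card_pm_on[OF _ card_edges_on_diff[OF assms(1,3,2)]] assms(1) by simp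

section \<open>First, second and third moments for arbitrary edge weights\<close>

lemma sum_insert_pm_on:
  assumes "finite W" "e \<in> edges_on W" "M \<in> pm_on (W - e)"
  shows "sum x (insert e M) = x e + sum x M"
  using assms edge_notin_pm_on[OF assms(2,3)] finite_pm_on_member[of "W - e" M] by simp

lemma sum_pm_on_first_moment:
  fixes x :: "'a set \<Rightarrow> real"
  assumes "finite W" "card W = 2 * Suc k"
  shows "(\<Sum>M\<in>pm_on W. sum x M) = odd_dfact k * sum x (edges_on W)"
proof -
  have "(\<Sum>M\<in>pm_on W. sum x M) = (\<Sum>e\<in>edges_on W. \<Sum>M\<in>pm_on (W - e). x e)"
    using sum_pm_on_edges[OF assms(1), of "\<lambda>e M. x e"] by simp
  also have "\<dots> = (\<Sum>e\<in>edges_on W. odd_dfact k * x e)"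
    by (intro sum.cong refl)
      (use assms card_edges_on_diff[OF assms(1) _ assms(2)] in \<open>simp add: card_pm_on\<close>)
  finally show ?thesis by (simp add: sum_distrib_left)
qed

lemma sum_pm_on_containing_first_moment:
  fixes x :: "'a set \<Rightarrow> real"
  assumes "finite W" "card W = 2 * Suc (Suc k)" "e \<in> edges_on W"
  shows "(\<Sum>M | M \<in> pm_on W \<and> e \<in> M. sum x M) =
    odd_dfact (Suc k) * x e + odd_dfact k * sum x (edges_on (W - e))"
proof -
  have cW: "card (W - e) = 2 * Suc k" using card_edges_on_diff[OF assms(1,3,2)] .
  have "(\<Sum>M | M \<in> pm_on W \<and> e \<in> M. sum x M) = (\<Sum>M\<in>pm_on (W - e). x e + sum x M)"
    unfolding sum_pm_on_containing[OF assms(3)]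
    by (intro sum.cong refl sum_insert_pm_on[OF assms(1,3)])
  then show ?thesis
    using cW assms by (simp add: sum.distrib sum_pm_on_first_moment card_pm_on)
qed

lemma sum_pm_on_second_moment:
  fixes x :: "'a set \<Rightarrow> real"
  assumes "finite W" "card W = 2 * Suc (Suc k)"
  shows "(\<Sum>M\<in>pm_on W. (sum x M)\<^sup>2) =
    (\<Sum>e\<in>edges_on W. x e * (odd_dfact (Suc k) * x e + odd_dfact k * sum x (edges_on (W - e))))"
proof -
  have "(\<Sum>M\<in>pm_on W. (sum x M)\<^sup>2) = (\<Sum>M\<in>pm_on W. \<Sum>e\<in>M. x e * sum x M)"
    by (simp add: power2_eq_square sum_distrib_right)
  also have "\<dots> = (\<Sum>e\<in>edges_on W. \<Sum>M\<in>pm_on (W - e). x e * sum x (insert e M))"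
    using sum_pm_on_edges[OF assms(1), of "\<lambda>e M. x e * sum x M"] .
  also have "\<dots> = (\<Sum>e\<in>edges_on W.
      x e * (odd_dfact (Suc k) * x e + odd_dfact k * sum x (edges_on (W - e))))"
    by (intro sum.cong refl)
      (simp add: sum_distrib_left[symmetric] sum_pm_on_containing[symmetric]
        sum_pm_on_containing_first_moment[OF assms])
  finally show ?thesis .
qed

text \<open>One factor is expanded over the edges \<open>e\<close> of the matching. The remaining
  square is \<open>(x e + sum x M)\<^sup>2\<close> with \<open>M\<close> a perfect matching of
  \<open>W - e\<close>, so the first two moments on \<open>W - e\<close> finish the
  computation.\<close>

lemma sum_pm_on_third_moment:
  fixes x :: "'a set \<Rightarrow> real"
  assumes "finite W" "card W = 2 * Suc (Suc (Suc k))"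
  shows "(\<Sum>M\<in>pm_on W. (sum x M) ^ 3) =
    (\<Sum>e\<in>edges_on W. x e * (odd_dfact (Suc (Suc k)) * (x e)\<^sup>2
      + 2 * x e * odd_dfact (Suc k) * sum x (edges_on (W - e))
      + (\<Sum>f\<in>edges_on (W - e). x f * (odd_dfact (Suc k) * x f
          + odd_dfact k * sum x (edges_on (W - e - f))))))"
proof -
  have "(\<Sum>M\<in>pm_on W. (sum x M) ^ 3) = (\<Sum>M\<in>pm_on W. \<Sum>e\<in>M. x e * (sum x M)\<^sup>2)"
    by (simp add: power2_eq_square power3_eq_cube sum_distrib_right mult.assoc)
  also have "\<dots> = (\<Sum>e\<in>edges_on W. \<Sum>M\<in>pm_on (W - e). x e * (sum x (insert e M))\<^sup>2)"
    using sum_pm_on_edges[OF assms(1), of "\<lambda>e M. x e * (sum x M)\<^sup>2"] .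
  also have "\<dots> = (\<Sum>e\<in>edges_on W. x e * (odd_dfact (Suc (Suc k)) * (x e)\<^sup>2
      + 2 * x e * odd_dfact (Suc k) * sum x (edges_on (W - e))
      + (\<Sum>f\<in>edges_on (W - e). x f * (odd_dfact (Suc k) * x f
          + odd_dfact k * sum x (edges_on (W - e - f))))))"
  proof (intro sum.cong refl)
    fix e assume e: "e \<in> edges_on W"
    have cW: "card (W - e) = 2 * Suc (Suc k)" using card_edges_on_diff[OF assms(1) e assms(2)] .
    have "(\<Sum>M\<in>pm_on (W - e). x e * (sum x (insert e M))\<^sup>2) =
      (\<Sum>M\<in>pm_on (W - e). x e * ((x e)\<^sup>2 + 2 * x e * sum x M + (sum x M)\<^sup>2))"
      by (intro sum.cong refl)
        (simp add: sum_insert_pm_on[OF assms(1) e] power2_sum algebra_simps)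
    also have "\<dots> = x e * (card (pm_on (W - e)) * (x e)\<^sup>2
        + 2 * x e * (\<Sum>M\<in>pm_on (W - e). sum x M) + (\<Sum>M\<in>pm_on (W - e). (sum x M)\<^sup>2))"
      by (simp add: sum_distrib_left sum.distrib distrib_left mult.assoc)
    finally show "(\<Sum>M\<in>pm_on (W - e). x e * (sum x (insert e M))\<^sup>2) =
      x e * (odd_dfact (Suc (Suc k)) * (x e)\<^sup>2
      + 2 * x e * odd_dfact (Suc k) * sum x (edges_on (W - e))
      + (\<Sum>f\<in>edges_on (W - e). x f * (odd_dfact (Suc k) * x f
          + odd_dfact k * sum x (edges_on (W - e - f)))))"
      using card_pm_on[OF _ cW] sum_pm_on_first_moment[OF _ cW, of x]
        sum_pm_on_second_moment[OF _ cW, of x] assms(1)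
      by (simp add: mult.assoc)
  qed
  finally show ?thesis .
qed

section \<open>Moments for weights whose sum at each vertex is zero\<close>

lemma sum_edges_on_endpoints:
  assumes "finite W"
  shows "(\<Sum>e\<in>edges_on W. \<Sum>a\<in>e. \<phi> e a) = (\<Sum>a\<in>W. \<Sum>e | e \<in> edges_on W \<and> a \<in> e. \<phi> e a)"
proof -
  have "(\<Sum>e\<in>edges_on W. \<Sum>a\<in>e. \<phi> e a) = (\<Sum>e\<in>edges_on W. \<Sum>a | a \<in> W \<and> a \<in> e. \<phi> e a)"
    by (intro sum.cong refl) (auto simp: edges_on_def)
  also have "\<dots> = (\<Sum>a\<in>W. \<Sum>e | e \<in> edges_on W \<and> a \<in> e. \<phi> e a)"
    using finite_edges_on[OF assms] assms by (rule sum.swap_restrict)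
  finally show ?thesis .
qed

lemma sum_edges_on_degree:
  fixes \<phi> :: "'a set \<Rightarrow> real"
  assumes "finite W"
  shows "(\<Sum>a\<in>W. \<Sum>e | e \<in> edges_on W \<and> a \<in> e. \<phi> e) = 2 * sum \<phi> (edges_on W)"
proof -
  have "(\<Sum>e\<in>edges_on W. \<Sum>a\<in>e. \<phi> e) = (\<Sum>e\<in>edges_on W. 2 * \<phi> e)"
    by (intro sum.cong refl) (simp add: edges_on_def)
  then show ?thesis using sum_edges_on_endpoints[OF assms, of "\<lambda>e a. \<phi> e"]
    by (simp add: sum_distrib_left)
qed

lemma bij_betw_edges_at:
  assumes "a \<in> W"
  shows "bij_betw (\<lambda>b. {a, b}) (W - {a}) {e \<in> edges_on W. a \<in> e}"
  using assms
  by (auto simp: bij_betw_def inj_on_def edges_on_def doubleton_eq_iff card_2_iff)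

lemma card_edges_at:
  assumes "a \<in> W" "finite W"
  shows "card {e \<in> edges_on W. a \<in> e} = card W - 1"
  using bij_betw_same_card[OF bij_betw_edges_at[OF assms(1)]] assms by simp

text \<open>Adding the zero sums at the vertices of \<open>Q\<close> counts edges inside
  \<open>Q\<close> twice and edges leaving \<open>Q\<close> once. Subtracting this from the zero
  total leaves the edges outside \<open>Q\<close> minus those inside.\<close>

lemma sum_edges_on_complement:
  fixes x :: "'a set \<Rightarrow> real"
  assumes W: "finite W" and Q: "Q \<subseteq> W"
    and rows: "\<And>v. v \<in> W \<Longrightarrow> (\<Sum>e | e \<in> edges_on W \<and> v \<in> e. x e) = 0"
  shows "sum x (edges_on (W - Q)) = sum x (edges_on Q)"
proof -
  note fE = finite_edges_on[OF W]
  have total: "sum x (edges_on W) = 0"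
    using sum_edges_on_degree[OF W, of x] rows by simp
  have "(\<Sum>e\<in>edges_on W. x e * card (e \<inter> Q)) =
      (\<Sum>e\<in>edges_on W. \<Sum>a\<in>e. if a \<in> Q then x e else 0)"
  proof (intro sum.cong refl)
    fix e assume "e \<in> edges_on W"
    then have "finite e" using W finite_subset by (auto simp: edges_on_def)
    then show "x e * card (e \<inter> Q) = (\<Sum>a\<in>e. if a \<in> Q then x e else 0)"
      by (simp add: sum.inter_restrict[symmetric])
  qed
  also have "\<dots> = (\<Sum>a\<in>W. if a \<in> Q then (\<Sum>e | e \<in> edges_on W \<and> a \<in> e. x e) else 0)"
    unfolding sum_edges_on_endpoints[OF W] by (intro sum.cong refl) auto
  also have "\<dots> = 0" using rows by (intro sum.neutral) auto
  finally have deg: "(\<Sum>e\<in>edges_on W. x e * card (e \<inter> Q)) = 0" .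
  have "sum x (edges_on W) = (\<Sum>e\<in>edges_on W. x e * card (e \<inter> Q)
      + (if e \<subseteq> W - Q then x e else 0) - (if e \<subseteq> Q then x e else 0))"
  proof (intro sum.cong refl)
    fix e assume "e \<in> edges_on W"
    then obtain a b where e: "e = {a, b}" "a \<noteq> b" "a \<in> W" "b \<in> W"
      by (auto simp: edges_on_def card_2_iff)
    show "x e = x e * card (e \<inter> Q) + (if e \<subseteq> W - Q then x e else 0) - (if e \<subseteq> Q then x e else 0)"
      using e by (cases "a \<in> Q"; cases "b \<in> Q") auto
  qed
  also have "\<dots> = (\<Sum>e\<in>edges_on W. if e \<subseteq> W - Q then x e else 0)
      - (\<Sum>e\<in>edges_on W. if e \<subseteq> Q then x e else 0)"
    using deg by (simp add: sum.distrib sum_subtractf)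
  also have "(\<Sum>e\<in>edges_on W. if e \<subseteq> W - Q then x e else 0) = sum x (edges_on (W - Q))"
    unfolding sum.inter_filter[OF fE, symmetric]
    by (rule sum.cong) (auto simp: edges_on_def)
  also have "(\<Sum>e\<in>edges_on W. if e \<subseteq> Q then x e else 0) = sum x (edges_on Q)"
    unfolding sum.inter_filter[OF fE, symmetric]
    by (rule sum.cong) (use Q in \<open>auto simp: edges_on_def\<close>)
  finally show ?thesis using total by simp
qed

lemma edges_on_edge:
  assumes "e \<in> edges_on W"
  shows "edges_on e = {e}"
proof -
  have "f = e" if "f \<subseteq> e" "card f = 2" for f
    using that assms card_subset_eq[of e f] card.infinite[of e] by (auto simp: edges_on_def)
  then show ?thesis using assms by (auto simp: edges_on_def)
qed

lemma sum_edges_on_diff_edge: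
  fixes x :: "'a set \<Rightarrow> real"
  assumes "finite W" "e \<in> edges_on W"
    and "\<And>v. v \<in> W \<Longrightarrow> (\<Sum>e | e \<in> edges_on W \<and> v \<in> e. x e) = 0"
  shows "sum x (edges_on (W - e)) = x e"
proof -
  have "e \<subseteq> W" using assms(2) by (simp add: edges_on_def)
  then show ?thesis
    using sum_edges_on_complement[OF assms(1) _ assms(3)] edges_on_edge[OF assms(2)] by simp
qed

lemma sum_disjoint_edges_swap:
  assumes "finite W"
  shows "(\<Sum>e\<in>edges_on W. \<Sum>f\<in>edges_on (W - e). \<phi> e f) =
    (\<Sum>f\<in>edges_on W. \<Sum>e\<in>edges_on (W - f). \<phi> e f)"
proof -
  have *: "edges_on (W - e) = {f. f \<in> edges_on W \<and> e \<inter> f = {}}" for e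
    by (auto simp: edges_on_def)
  have **: "edges_on (W - f) = {e. e \<in> edges_on W \<and> e \<inter> f = {}}" for f
    by (auto simp: edges_on_def)
  show ?thesis
    unfolding * using sum.swap_restrict[OF finite_edges_on[OF assms] finite_edges_on[OF assms],
        of \<phi> "\<lambda>e f. e \<inter> f = {}"]
    unfolding **[symmetric] *[symmetric] .
qed

text \<open>The weight disjoint from \<open>e\<close> equals \<open>x e\<close>, so the off-diagonal
  part of the second moment is again a multiple of the sum of squares.\<close>

lemma second_moment_zero_rows:
  fixes x :: "'a set \<Rightarrow> real"
  assumes "finite W" "card W = 2 * Suc (Suc k)"
    and "\<And>v. v \<in> W \<Longrightarrow> (\<Sum>e | e \<in> edges_on W \<and> v \<in> e. x e) = 0"
  shows "(\<Sum>M\<in>pm_on W. (sum x M)\<^sup>2) =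
    (odd_dfact (Suc k) + odd_dfact k) * (\<Sum>e\<in>edges_on W. (x e)\<^sup>2)"
  unfolding sum_pm_on_second_moment[OF assms(1,2)] sum_distrib_left[of _ _ "edges_on W"]
proof (intro sum.cong refl)
  fix e assume "e \<in> edges_on W"
  note sum_edges_on_diff_edge[OF assms(1) this assms(3)]
  then show "x e * (odd_dfact (Suc k) * x e + odd_dfact k * sum x (edges_on (W - e))) =
    (odd_dfact (Suc k) + odd_dfact k) * (x e)\<^sup>2"
    by (simp only: power2_eq_square of_nat_add) (simp add: algebra_simps)
qed

text \<open>The weight avoiding \<open>e\<close> is \<open>x e\<close>, and the weight avoiding two
  disjoint edges is that of the six edges on their four endpoints. The coefficient \<open>3\<close>
  collects two cubes from the mixed term of the square and one from the terms
  \<open>x e * (x f)\<^sup>2\<close>.\<close>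

lemma third_moment_zero_rows:
  fixes x :: "'a set \<Rightarrow> real"
  assumes W: "finite W" and cW: "card W = 2 * Suc (Suc (Suc k))"
    and rows: "\<And>v. v \<in> W \<Longrightarrow> (\<Sum>e | e \<in> edges_on W \<and> v \<in> e. x e) = 0"
  shows "(\<Sum>M\<in>pm_on W. (sum x M) ^ 3) =
    (odd_dfact (Suc (Suc k)) + 3 * odd_dfact (Suc k)) * (\<Sum>e\<in>edges_on W. x e ^ 3)
    + odd_dfact k * (\<Sum>e\<in>edges_on W. \<Sum>f\<in>edges_on (W - e). x e * x f * sum x (edges_on (e \<union> f)))"
proof -
  let ?E = "edges_on W" and ?d = "\<lambda>j. real (odd_dfact j)"
  have diff: "sum x (edges_on (W - e)) = x e" if "e \<in> ?E" for e
    using sum_edges_on_diff_edge[OF W that rows] .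
  have diff2: "sum x (edges_on (W - e - f)) = sum x (edges_on (e \<union> f))"
    if "e \<in> ?E" "f \<in> edges_on (W - e)" for e f
  proof -
    have "e \<union> f \<subseteq> W" using that by (auto simp: edges_on_def)
    moreover have "W - e - f = W - (e \<union> f)" by auto
    ultimately show ?thesis using sum_edges_on_complement[OF W _ rows] by simp
  qed
  have "(\<Sum>M\<in>pm_on W. (sum x M) ^ 3) = (\<Sum>e\<in>?E. (?d (Suc (Suc k)) + 2 * ?d (Suc k)) * x e ^ 3
      + ?d (Suc k) * (\<Sum>f\<in>edges_on (W - e). x e * (x f)\<^sup>2)
      + ?d k * (\<Sum>f\<in>edges_on (W - e). x e * x f * sum x (edges_on (e \<union> f))))"
    unfolding sum_pm_on_third_moment[OF W cW]
  proof (intro sum.cong refl)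
    fix e assume e: "e \<in> ?E"
    have "(\<Sum>f\<in>edges_on (W - e). x f * (?d (Suc k) * x f + ?d k * sum x (edges_on (W - e - f)))) =
      (\<Sum>f\<in>edges_on (W - e). ?d (Suc k) * (x f)\<^sup>2 + ?d k * (x f * sum x (edges_on (e \<union> f))))"
      by (intro sum.cong refl) (simp add: diff2[OF e] power2_eq_square algebra_simps)
    also have "\<dots> = ?d (Suc k) * (\<Sum>f\<in>edges_on (W - e). (x f)\<^sup>2)
        + ?d k * (\<Sum>f\<in>edges_on (W - e). x f * sum x (edges_on (e \<union> f)))"
      by (simp add: sum.distrib sum_distrib_left)
    finally have inner: "(\<Sum>f\<in>edges_on (W - e). x f * (?d (Suc k) * x f
        + ?d k * sum x (edges_on (W - e - f)))) = \<dots>" .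
    have l: "(\<Sum>f\<in>edges_on (W - e). x e * (x f)\<^sup>2) = x e * (\<Sum>f\<in>edges_on (W - e). (x f)\<^sup>2)"
      "(\<Sum>f\<in>edges_on (W - e). x e * x f * sum x (edges_on (e \<union> f))) =
        x e * (\<Sum>f\<in>edges_on (W - e). x f * sum x (edges_on (e \<union> f)))"
      by (simp_all add: sum_distrib_left mult.assoc)
    show "x e * (?d (Suc (Suc k)) * (x e)\<^sup>2 + 2 * x e * ?d (Suc k) * sum x (edges_on (W - e))
      + (\<Sum>f\<in>edges_on (W - e). x f * (?d (Suc k) * x f + ?d k * sum x (edges_on (W - e - f))))) =
      (?d (Suc (Suc k)) + 2 * ?d (Suc k)) * x e ^ 3
      + ?d (Suc k) * (\<Sum>f\<in>edges_on (W - e). x e * (x f)\<^sup>2)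
      + ?d k * (\<Sum>f\<in>edges_on (W - e). x e * x f * sum x (edges_on (e \<union> f)))"
      unfolding inner l diff[OF e] by (simp add: power2_eq_square power3_eq_cube algebra_simps)
  qed
  also have "\<dots> = (?d (Suc (Suc k)) + 2 * ?d (Suc k)) * (\<Sum>e\<in>?E. x e ^ 3)
      + ?d (Suc k) * (\<Sum>e\<in>?E. \<Sum>f\<in>edges_on (W - e). x e * (x f)\<^sup>2)
      + ?d k * (\<Sum>e\<in>?E. \<Sum>f\<in>edges_on (W - e). x e * x f * sum x (edges_on (e \<union> f)))"
    by (simp only: sum.distrib sum_distrib_left)
  \<comment> \<open>After exchanging the order, the inner sum is the weight disjoint from the
    squared edge, which is one more factor of that edge's own weight.\<close>
  also have "(\<Sum>e\<in>?E. \<Sum>f\<in>edges_on (W - e). x e * (x f)\<^sup>2) = (\<Sum>e\<in>?E. x e ^ 3)"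
    by (subst sum_disjoint_edges_swap[OF W], intro sum.cong refl)
      (simp add: sum_distrib_right[symmetric] diff power2_eq_square power3_eq_cube)
  finally show ?thesis by (simp add: algebra_simps)
qed

text \<open>Of the six edges on the endpoints of \<open>e\<close> and \<open>f\<close>, the edges
  \<open>e\<close> and \<open>f\<close> themselves together account for
  \<open>\<rho> * card W\<close> times the sum of squares, and the four crossing edges for twice as
  much.\<close>

lemma third_moment_remainder_bound:
  fixes x :: "'a set \<Rightarrow> real"
  assumes W: "finite W"
    and rows: "\<And>v. v \<in> W \<Longrightarrow> (\<Sum>e | e \<in> edges_on W \<and> v \<in> e. \<bar>x e\<bar>) \<le> \<rho>"
  shows "\<bar>\<Sum>e\<in>edges_on W. \<Sum>f\<in>edges_on (W - e). x e * x f * sum x (edges_on (e \<union> f))\<bar>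
    \<le> 3 * \<rho> * card W * (\<Sum>e\<in>edges_on W. (x e)\<^sup>2)"
proof (cases "W = {}")
  case True
  then have "edges_on W = {}" by (auto simp: edges_on_def)
  then show ?thesis by simp
next
  case False
  let ?E = "edges_on W" and ?y = "\<lambda>a c. if a = c then 0 else \<bar>x {a, c}\<bar>"
  define r where "r v = (\<Sum>e | e \<in> ?E \<and> v \<in> e. \<bar>x e\<bar>)" for v
  define S where "S = (\<Sum>e\<in>?E. (x e)\<^sup>2)"
  note fE = finite_edges_on[OF W]
  have r0: "r v \<ge> 0" for v unfolding r_def by (intro sum_nonneg) auto
  have r\<rho>: "r v \<le> \<rho>" if "v \<in> W" for v using rows[OF that] by (simp add: r_def)
  obtain v where "v \<in> W" using False by auto
  then have \<rho>0: "\<rho> \<ge> 0" using r0[of v] r\<rho>[of v] by simp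
  have S0: "S \<ge> 0" unfolding S_def by (intro sum_nonneg) auto
  have ry: "(\<Sum>c\<in>W. ?y a c) = r a" if "a \<in> W" for a
  proof -
    have "(\<Sum>c\<in>W. ?y a c) = (\<Sum>c\<in>W - {a}. \<bar>x {a, c}\<bar>)"
      using W that by (intro sum.mono_neutral_cong_right) auto
    also have "\<dots> = r a"
      unfolding r_def using sum.reindex_bij_betw[OF bij_betw_edges_at[OF that], of "\<lambda>e. \<bar>x e\<bar>"] by simp
    finally show ?thesis .
  qed
  have edge_weight: "(\<Sum>f\<in>?E. \<bar>x f\<bar> * (\<Sum>c\<in>f. G c)) = (\<Sum>c\<in>W. G c * r c)" for G
    unfolding r_def
    using sum_edges_on_endpoints[OF W, of "\<lambda>f c. \<bar>x f\<bar> * G c"]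
    by (simp add: sum_distrib_left mult.commute)
  have sw: "(\<Sum>a\<in>e. \<Sum>c\<in>f. ?y a c) = (\<Sum>c\<in>f. \<Sum>a\<in>e. ?y a c)" for e f
    by (rule sum.swap)
  have sw': "(\<Sum>c\<in>W. (\<Sum>a\<in>e. ?y a c) * r c) = (\<Sum>a\<in>e. \<Sum>c\<in>W. ?y a c * r c)" for e
    unfolding sum_distrib_right by (rule sum.swap)
  have split: "\<bar>sum x (edges_on (e \<union> f))\<bar> \<le> \<bar>x e\<bar> + \<bar>x f\<bar> + (\<Sum>a\<in>e. \<Sum>c\<in>f. ?y a c)"
    if e: "e \<in> ?E" and f: "f \<in> edges_on (W - e)" for e f
  proof -
    obtain a b where ab: "e = {a, b}" "a \<noteq> b" using e by (auto simp: edges_on_def card_2_iff)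
    obtain c d where cd: "f = {c, d}" "c \<noteq> d" using f by (auto simp: edges_on_def card_2_iff)
    have ne: "a \<noteq> c" "a \<noteq> d" "b \<noteq> c" "b \<noteq> d" using f ab cd by (auto simp: edges_on_def)
    have "edges_on (e \<union> f) = {{a, b}, {c, d}, {a, c}, {a, d}, {b, c}, {b, d}}" (is "_ = ?H")
    proof (intro equalityI subsetI)
      fix h assume "h \<in> edges_on (e \<union> f)"
      then obtain p q where "h = {p, q}" "p \<noteq> q" "p \<in> {a, b, c, d}" "q \<in> {a, b, c, d}"
        by (auto simp: ab cd edges_on_def card_2_iff)
      then show "h \<in> ?H" by (elim insertE emptyE) (simp_all add: insert_commute)
    next
      fix h assume "h \<in> ?H"
      then show "h \<in> edges_on (e \<union> f)"
        using ab cd ne by (elim insertE emptyE) (simp_all add: edges_on_def)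
    qed
    also have "sum x \<dots> = x {a, b} + x {c, d} + (x {a, c} + x {a, d} + (x {b, c} + x {b, d}))"
      using ab cd ne by (simp add: doubleton_eq_iff)
    finally show ?thesis using ab cd ne by simp
  qed
  have "\<bar>\<Sum>e\<in>?E. \<Sum>f\<in>edges_on (W - e). x e * x f * sum x (edges_on (e \<union> f))\<bar>
      \<le> (\<Sum>e\<in>?E. \<Sum>f\<in>edges_on (W - e). \<bar>x e * x f * sum x (edges_on (e \<union> f))\<bar>)"
    by (rule order_trans[OF sum_abs]) (intro sum_mono sum_abs)
  also have "\<dots> \<le> (\<Sum>e\<in>?E. \<Sum>f\<in>edges_on (W - e).
      \<bar>x e\<bar> * \<bar>x f\<bar> * (\<bar>x e\<bar> + \<bar>x f\<bar> + (\<Sum>a\<in>e. \<Sum>c\<in>f. ?y a c)))"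
    by (intro sum_mono) (simp add: abs_mult mult_left_mono split)
  \<comment> \<open>All terms are nonnegative, so \<open>f\<close> may range over all edges, which
    decouples the two sums. When \<open>f\<close> meets \<open>e\<close>, the zero diagonal of
    \<open>?y\<close> keeps \<open>x\<close> from being evaluated at a singleton.\<close>
  also have "\<dots> \<le> (\<Sum>e\<in>?E. \<Sum>f\<in>?E.
      \<bar>x e\<bar> * \<bar>x f\<bar> * (\<bar>x e\<bar> + \<bar>x f\<bar> + (\<Sum>a\<in>e. \<Sum>c\<in>f. ?y a c)))"
    by (intro sum_mono sum_mono2 fE mult_nonneg_nonneg add_nonneg_nonneg sum_nonneg)
      (auto simp: edges_on_def)
  also have "\<dots> = (\<Sum>e\<in>?E. \<Sum>f\<in>?E. (x e)\<^sup>2 * \<bar>x f\<bar>) + (\<Sum>e\<in>?E. \<Sum>f\<in>?E. \<bar>x e\<bar> * (x f)\<^sup>2)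
      + (\<Sum>e\<in>?E. \<Sum>f\<in>?E. \<bar>x e\<bar> * \<bar>x f\<bar> * (\<Sum>a\<in>e. \<Sum>c\<in>f. ?y a c))"
    unfolding sum.distrib[symmetric]
  proof (intro sum.cong refl)
    fix e f
    have "\<bar>x e\<bar> * \<bar>x e\<bar> = (x e)\<^sup>2" "\<bar>x f\<bar> * \<bar>x f\<bar> = (x f)\<^sup>2" by (simp_all add: power2_eq_square)
    then show "\<bar>x e\<bar> * \<bar>x f\<bar> * (\<bar>x e\<bar> + \<bar>x f\<bar> + (\<Sum>a\<in>e. \<Sum>c\<in>f. ?y a c)) =
      (x e)\<^sup>2 * \<bar>x f\<bar> + \<bar>x e\<bar> * (x f)\<^sup>2 + \<bar>x e\<bar> * \<bar>x f\<bar> * (\<Sum>a\<in>e. \<Sum>c\<in>f. ?y a c)"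
      by (simp only: distrib_left) (simp add: mult_ac)
  qed
  also have "(\<Sum>e\<in>?E. \<Sum>f\<in>?E. (x e)\<^sup>2 * \<bar>x f\<bar>) = S * (\<Sum>f\<in>?E. \<bar>x f\<bar>)"
    by (simp add: S_def sum_product)
  also have "(\<Sum>e\<in>?E. \<Sum>f\<in>?E. \<bar>x e\<bar> * (x f)\<^sup>2) = S * (\<Sum>f\<in>?E. \<bar>x f\<bar>)"
    by (simp add: S_def sum_product mult.commute)
  also have "(\<Sum>f\<in>?E. \<bar>x f\<bar>) = (\<Sum>v\<in>W. r v) / 2"
    using sum_edges_on_degree[OF W, of "\<lambda>e. \<bar>x e\<bar>"] by (simp add: r_def)
  also have "(\<Sum>e\<in>?E. \<Sum>f\<in>?E. \<bar>x e\<bar> * \<bar>x f\<bar> * (\<Sum>a\<in>e. \<Sum>c\<in>f. ?y a c)) =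
      (\<Sum>e\<in>?E. \<bar>x e\<bar> * (\<Sum>f\<in>?E. \<bar>x f\<bar> * (\<Sum>c\<in>f. \<Sum>a\<in>e. ?y a c)))"
    by (simp only: sum_distrib_left mult.assoc sw)
  also have "\<dots> = (\<Sum>e\<in>?E. \<bar>x e\<bar> * (\<Sum>a\<in>e. \<Sum>c\<in>W. ?y a c * r c))"
    by (simp only: edge_weight sw')
  \<comment> \<open>The crossing part is now a sum over walks of length three: \<open>?y a c\<close>
    weighs the middle edge, \<open>r a\<close> and \<open>r c\<close> the outer ones.\<close>
  also have "\<dots> = (\<Sum>a\<in>W. (\<Sum>c\<in>W. ?y a c * r c) * r a)"
    unfolding edge_weight ..
  also have "\<dots> \<le> (\<Sum>a\<in>W. \<rho> * (r a)\<^sup>2)"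
  proof (rule sum_mono)
    fix a assume a: "a \<in> W"
    have "(\<Sum>c\<in>W. ?y a c * r c) \<le> (\<Sum>c\<in>W. ?y a c * \<rho>)"
      by (intro sum_mono mult_left_mono r\<rho>) auto
    also have "\<dots> = r a * \<rho>" by (simp only: sum_distrib_right[symmetric] ry[OF a])
    finally have "(\<Sum>c\<in>W. ?y a c * r c) * r a \<le> r a * \<rho> * r a"
      by (rule mult_right_mono) (rule r0)
    then show "(\<Sum>c\<in>W. ?y a c * r c) * r a \<le> \<rho> * (r a)\<^sup>2"
      by (simp add: power2_eq_square mult_ac)
  qed
  also have "\<dots> \<le> (\<Sum>a\<in>W. \<rho> * (card W * (\<Sum>e | e \<in> ?E \<and> a \<in> e. (x e)\<^sup>2)))"
  proof (intro sum_mono mult_left_mono \<rho>0)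
    fix a assume a: "a \<in> W"
    \<comment> \<open>Cauchy-Schwarz over the \<open>card W - 1\<close> edges at
      \<open>a\<close>.\<close>
    have "(r a)\<^sup>2 \<le> card {e \<in> ?E. a \<in> e} * (\<Sum>e | e \<in> ?E \<and> a \<in> e. (x e)\<^sup>2)"
      unfolding r_def
      using sum_squared_le_sum_of_squares[of "\<lambda>e. \<bar>x e\<bar>" "{e \<in> ?E. a \<in> e}"] fE by (simp add: mult.commute)
    also have "\<dots> \<le> card W * (\<Sum>e | e \<in> ?E \<and> a \<in> e. (x e)\<^sup>2)"
      by (intro mult_right_mono sum_nonneg) (simp_all add: card_edges_at[OF a W])
    finally show "(r a)\<^sup>2 \<le> card W * (\<Sum>e | e \<in> ?E \<and> a \<in> e. (x e)\<^sup>2)" .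
  qed
  also have "\<dots> = \<rho> * card W * (2 * S)"
    using sum_edges_on_degree[OF W, of "\<lambda>e. (x e)\<^sup>2"]
    by (simp add: S_def sum_distrib_left[symmetric] mult.assoc)
  also have "S * ((\<Sum>v\<in>W. r v) / 2) + S * ((\<Sum>v\<in>W. r v) / 2) = S * (\<Sum>v\<in>W. r v)" by simp
  also have "\<dots> \<le> S * (card W * \<rho>)"
    using sum_bounded_above[of W r \<rho>] r\<rho> S0 by (intro mult_left_mono) auto
  finally show ?thesis by (simp add: S_def algebra_simps)
qed

lemma card_pm_on_member:
  assumes "finite W" "M \<in> pm_on W"
  shows "2 * card M = card W"
proof -
  have fM: "finite M" using finite_pm_on_member[OF assms] .
  have "2 * card M = (\<Sum>e\<in>M. \<Sum>v | v \<in> W \<and> v \<in> e. 1)"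
  proof -
    have "(\<Sum>v | v \<in> W \<and> v \<in> e. 1) = (2::nat)" if "e \<in> M" for e
    proof -
      have "{v. v \<in> W \<and> v \<in> e} = e" "card e = 2"
        using pm_on_subset[OF assms(2)] that by (auto simp: edges_on_def)
      then show ?thesis by simp
    qed
    then show ?thesis by simp
  qed
  also have "\<dots> = (\<Sum>v\<in>W. \<Sum>e | e \<in> M \<and> v \<in> e. 1)"
    using fM assms(1) by (rule sum.swap_restrict)
  also have "\<dots> = card W"
    using pm_on_unique_edge[OF assms(2)] by simp
  finally show ?thesis .
qed

section \<open>Projection onto the span of the stars\<close>

interpretation fs: vector_space "fun_scale :: real \<Rightarrow> ('a \<Rightarrow> real) \<Rightarrow> 'a \<Rightarrow> real"
  by (rule vector_space_fun_scale)

lemma sum_fun_scale_apply: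
  "(\<Sum>i\<in>I. fun_scale (a i) (\<phi> i)) v = (\<Sum>i\<in>I. a i * \<phi> i v)"
  by (induction I rule: infinite_finite_induct) (auto simp: fun_scale_def)

lemma star_span_combination: "(\<Sum>e\<in>K_edges n. fun_scale (a e) (indicator (star n e))) \<in> star_span n"
  unfolding star_span_def
  by (intro fs.span_sum fs.span_scale fs.span_base) (auto simp: stars_def)

text \<open>Uniqueness of the projection means equality of total functions, while orthogonality only
  controls values on matchings; this supplies the values elsewhere.\<close>

lemma star_span_vanishes:
  assumes "f \<in> star_span n" "M \<notin> perfect_matchings n"
  shows "f M = 0"
  using assms(1) unfolding star_span_def
proof (induction rule: fs.span_induct_alt)
  case base
  show ?case by simp
next
  case (step r s y)
  then show ?case using assms(2) by (auto simp: stars_def star_def fun_scale_def)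
qed

lemma pm_inner_star_span_eq_0:
  assumes "h \<in> star_span n"
    and "\<And>e. e \<in> K_edges n \<Longrightarrow> pm_inner n f (indicator (star n e)) = 0"
  shows "pm_inner n f h = 0"
  using assms(1) unfolding star_span_def
proof (induction rule: fs.span_induct_alt)
  case base
  show ?case by (simp add: pm_inner_def)
next
  case (step r s y)
  have "pm_inner n f (fun_scale r s + y) = r * pm_inner n f s + pm_inner n f y"
    by (simp add: pm_inner_def fun_scale_def distrib_left sum.distrib sum_distrib_left mult_ac)
  moreover have "pm_inner n f s = 0" using step assms(2) by (auto simp: stars_def)
  ultimately show ?case using step by (simp add: plus_fun_def)
qed

text \<open>By linearity, orthogonality to the stars extends to their span. Two candidates differ by
  an element of the span orthogonal to itself; it vanishes on matchings because its squares sum to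
  zero, and elsewhere because it lies in the span.\<close>

lemma Proj_star_span_eqI:
  assumes g: "g \<in> star_span n"
    and orth: "\<And>e. e \<in> K_edges n \<Longrightarrow> pm_inner n (f - g) (indicator (star n e)) = 0"
  shows "Proj n (star_span n) f = g"
  unfolding Proj_def
proof (rule the_equality)
  have g_orth: "pm_inner n (f - g) h = 0" if "h \<in> star_span n" for h
    using pm_inner_star_span_eq_0[OF that orth] .
  then show "g \<in> star_span n \<and> (\<forall>h\<in>star_span n. pm_inner n (f - g) h = 0)" using g by blast
  fix g' assume g': "g' \<in> star_span n \<and> (\<forall>h\<in>star_span n. pm_inner n (f - g') h = 0)"
  have fin: "finite (perfect_matchings n)"
    by (simp add: perfect_matchings_eq_pm_on finite_pm_on)
  have d: "g' - g \<in> star_span n"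
    using g g' unfolding star_span_def by (intro fs.span_diff) auto
  have "pm_inner n (g' - g) (g' - g) = pm_inner n (f - g) (g' - g) - pm_inner n (f - g') (g' - g)"
  proof -
    have "(\<Sum>M\<in>perfect_matchings n. (g' - g) M * (g' - g) M) =
      (\<Sum>M\<in>perfect_matchings n. (f - g) M * (g' - g) M) - (\<Sum>M\<in>perfect_matchings n. (f - g') M * (g' - g) M)"
      unfolding sum_subtractf[symmetric] by (intro sum.cong refl) (simp add: algebra_simps)
    then show ?thesis unfolding pm_inner_def by (simp only: right_diff_distrib)
  qed
  also have "\<dots> = 0" using g_orth[OF d] g' d by simp
  \<comment> \<open>Finiteness allows the factor \<open>1 / card\<close> to be dropped: a zero
    cardinality would mean an empty sum.\<close>
  finally have "(\<Sum>M\<in>perfect_matchings n. (g' - g) M * (g' - g) M) = 0"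
    using fin by (auto simp: pm_inner_def)
  then have "\<forall>M\<in>perfect_matchings n. (g' - g) M * (g' - g) M = 0"
    by (subst (asm) sum_nonneg_eq_0_iff[OF fin]) auto
  then have "(g' - g) M = 0" for M
    using star_span_vanishes[OF d] by (cases "M \<in> perfect_matchings n") auto
  then show "g' = g" by (auto simp: fun_eq_iff)
qed

section \<open>Unions of stars, and the range in which any stars suffice\<close>

lemma ex_nested_subset_card:
  assumes "finite X" "Y \<subseteq> X" "r \<le> card X"
  shows "\<exists>Z\<subseteq>X. card Z = r \<and> (Z \<subseteq> Y \<or> Y \<subseteq> Z)"
proof (cases "r \<le> card Y")
  case True
  then obtain Z where "Z \<subseteq> Y" "card Z = r" by (meson obtain_subset_with_card_n)
  then show ?thesis using assms(2) by blast
next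
  case False
  have fY: "finite Y" using assms finite_subset by auto
  have "r - card Y \<le> card (X - Y)"
    using assms fY by (simp add: card_Diff_subset)
  then obtain Z where Z: "Z \<subseteq> X - Y" "card Z = r - card Y" by (meson obtain_subset_with_card_n)
  have "card (Y \<union> Z) = r"
    using Z False fY assms(1) finite_subset[of Z X] by (subst card_Un_disjoint) auto
  then show ?thesis using Z assms(2) by (intro exI[of _ "Y \<union> Z"]) auto
qed

text \<open>A Bonferroni bound by induction: a new set of size \<open>s\<close> loses at most
  \<open>card \<S> * D\<close> to the union of the earlier ones. The square is a convenient
  overestimate of the number of pairs.\<close>

lemma card_Union_lower:
  fixes s D :: real
  assumes "finite \<S>" "\<And>X. X \<in> \<S> \<Longrightarrow> finite X \<and> real (card X) = s" "D \<ge> 0"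
    and "\<And>X Y. X \<in> \<S> \<Longrightarrow> Y \<in> \<S> \<Longrightarrow> X \<noteq> Y \<Longrightarrow> real (card (X \<inter> Y)) \<le> D"
  shows "card \<S> * s - (card \<S>)\<^sup>2 * D \<le> card (\<Union>\<S>)"
  using assms
proof (induction \<S>)
  case empty
  then show ?case by simp
next
  case (insert X \<S>)
  have IH: "card \<S> * s - (card \<S>)\<^sup>2 * D \<le> card (\<Union>\<S>)"
    using insert.prems by (intro insert.IH) auto
  have f: "finite X" "finite (\<Union>\<S>)" using insert by auto
  have "card (X \<inter> \<Union>\<S>) \<le> (\<Sum>Y\<in>\<S>. card (X \<inter> Y))"
    unfolding Int_Union using card_UN_le[OF insert.hyps(1)] .
  then have "real (card (X \<inter> \<Union>\<S>)) \<le> (\<Sum>Y\<in>\<S>. real (card (X \<inter> Y)))"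
    unfolding of_nat_sum[symmetric] of_nat_le_iff .
  also have "\<dots> \<le> (\<Sum>Y\<in>\<S>. D)"
    using insert.hyps(2) by (intro sum_mono insert.prems(3)) auto
  finally have "real (card (X \<inter> \<Union>\<S>)) \<le> card \<S> * D" by simp
  moreover have "real (card X) + card (\<Union>\<S>) = card (\<Union>(insert X \<S>)) + card (X \<inter> \<Union>\<S>)"
    using card_Un_Int[OF f] by (simp only: Union_insert of_nat_add[symmetric])
  moreover have "card \<S> * D + (card \<S>)\<^sup>2 * D \<le> (card (insert X \<S>))\<^sup>2 * D"
  proof -
    have "real (card \<S>) + (card \<S>)\<^sup>2 \<le> (card (insert X \<S>))\<^sup>2"
      using insert.hyps by (simp add: power2_eq_square algebra_simps)
    from mult_right_mono[OF this insert.prems(2)] show ?thesis by (simp add: distrib_right)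
  qed
  moreover have "real (card (insert X \<S>)) * s = card \<S> * s + card X"
    using insert.hyps insert.prems(1)[of X] by (simp add: algebra_simps)
  ultimately show ?case using IH by linarith
qed

lemma card_star_eq:
  assumes "n \<ge> 1" "e \<in> K_edges n"
  shows "card (star n e) = odd_dfact (n - 1)"
proof -
  have "card {..<2 * n} = 2 * Suc (n - 1)" using assms(1) by simp
  then show ?thesis
    using card_pm_on_containing[of "{..<2 * n}" "n - 1" e] assms(2)
    unfolding star_def perfect_matchings_eq_pm_on K_edges_eq_edges_on by blast
qed

lemma finite_stars: "finite (stars n)"
  by (simp add: stars_def K_edges_eq_edges_on finite_edges_on)

lemma finite_perfect_matchings: "finite (perfect_matchings n)"
  by (simp add: perfect_matchings_eq_pm_on finite_pm_on)

lemma finite_star: "finite (star n e)"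
  by (simp add: star_def finite_perfect_matchings)

text \<open>The stars of the edges at vertex \<open>0\<close> are distinct: each is nonempty, and no
  matching contains two different edges at \<open>0\<close>.\<close>

lemma card_stars_ge:
  assumes "n \<ge> 1"
  shows "2 * n - 1 \<le> card (stars n)"
proof -
  have edge: "{0, j} \<in> K_edges n" if "j \<in> {1..<2 * n}" for j
    using that by (auto simp: K_edges_def)
  have "inj_on (\<lambda>j. star n {0, j}) {1..<2 * n}"
  proof (rule inj_onI)
    fix i j assume ij: "i \<in> {1..<2 * n}" "j \<in> {1..<2 * n}" "star n {0, i} = star n {0, j}"
    have "card (star n {0, i}) > 0"
      using card_star_eq[OF assms edge[OF ij(1)]] odd_dfact_pos by simp
    then obtain M where "M \<in> star n {0, i}" by (metis card_gt_0_iff ex_in_conv)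
    with ij(3) have "M \<in> pm_on {..<2 * n}" "{0, i} \<in> M" "{0, j} \<in> M"
      by (auto simp: star_def perfect_matchings_eq_pm_on)
    then have "{0, i} = {0, j} \<or> {0, i} \<inter> {0, j} = {}" using pm_on_disjoint by metis
    then have "{0, i} = {0, j}" by simp
    then show "i = j" by (auto simp: doubleton_eq_iff)
  qed
  then have "2 * n - 1 = card ((\<lambda>j. star n {0, j}) ` {1..<2 * n})"
    by (simp add: card_image)
  also have "\<dots> \<le> card (stars n)"
    by (intro card_mono finite_stars) (auto simp: stars_def edge)
  finally show ?thesis .
qed

text \<open>Rounding adds at most \<open>1 / 2\<close>, so the bound on \<open>c\<close> gives
  \<open>round c \<le> n\<close>, and there are at least \<open>2 * n - 1 \<ge> n\<close>
  stars.\<close>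

lemma round_le_card_stars:
  assumes "n \<ge> 1" "0 \<le> c" "c \<le> (2 * real n - 1) / 2"
  shows "nat (round c) \<le> card (stars n)"
proof -
  have "of_int (round c) \<le> c + 1 / 2" using of_int_round_le .
  then have "of_int (round c) \<le> real n" using assms by simp
  then have "nat (round c) \<le> n" by linarith
  then show ?thesis using card_stars_ge[OF assms(1)] assms(1) by linarith
qed

lemma round_nonneg: "0 \<le> (c :: real) \<Longrightarrow> 0 \<le> round c"
  unfolding round_def by simp

text \<open>When the allowed error is at least \<open>3 * c\<close>, counting alone suffices. For
  \<open>c < 1 / 2\<close> the empty union has error \<open>c\<close>; otherwise
  \<open>round c \<le> 2 * c\<close>, and any \<open>round c\<close> stars differ from
  \<open>A\<close> by at most the sum of both sizes.\<close>

lemma approximation_by_arbitrary_stars: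
  fixes c \<beta> :: real
  assumes "n \<ge> 1" "A \<subseteq> perfect_matchings n" and cA: "real (card A) = c * odd_dfact (n - 1)"
    and "0 \<le> c" "c \<le> (2 * real n - 1) / 2" and \<beta>: "3 * c \<le> \<beta>"
  shows "\<exists>\<S>\<subseteq>stars n. int (card \<S>) = round c \<and>
    real (card ((A - \<Union>\<S>) \<union> (\<Union>\<S> - A))) \<le> \<beta> * odd_dfact (n - 1) \<and> \<bar>c - round c\<bar> \<le> \<beta>"
proof (cases "c < 1 / 2")
  case True
  then have r: "round c = 0" using assms(4) by (intro round_unique') auto
  have "c * odd_dfact (n - 1) \<le> \<beta> * odd_dfact (n - 1)"
    using assms by (intro mult_right_mono) auto
  then show ?thesis using r assms by (intro exI[of _ "{}"]) auto
next
  case False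
  obtain \<S> where S: "\<S> \<subseteq> stars n" "card \<S> = nat (round c)"
    using round_le_card_stars[OF assms(1,4,5)] by (meson obtain_subset_with_card_n)
  have r: "int (card \<S>) = round c" using S round_nonneg assms(4) by simp
  have "finite (\<Union>\<S>)"
    using finite_subset[OF S(1) finite_stars] S(1) by (intro finite_Union) (auto simp: stars_def finite_star)
  then have "card ((A - \<Union>\<S>) \<union> (\<Union>\<S> - A)) \<le> card (A \<union> \<Union>\<S>)"
    using finite_subset[OF assms(2) finite_perfect_matchings] by (intro card_mono) auto
  also have "\<dots> \<le> card A + card (\<Union>\<S>)" by (rule card_Un_le)
  also have "card (\<Union>\<S>) \<le> (\<Sum>X\<in>\<S>. card X)"
    using card_UN_le[OF finite_subset[OF S(1) finite_stars], of id] by simp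
  also have "\<dots> = (\<Sum>X\<in>\<S>. odd_dfact (n - 1))"
    using S card_star_eq[OF assms(1)] by (intro sum.cong) (auto simp: stars_def)
  finally have "card ((A - \<Union>\<S>) \<union> (\<Union>\<S> - A)) \<le> card A + card \<S> * odd_dfact (n - 1)"
    by simp
  then have "real (card ((A - \<Union>\<S>) \<union> (\<Union>\<S> - A))) \<le> card A + real (card \<S>) * odd_dfact (n - 1)"
    by (metis of_nat_add of_nat_le_iff of_nat_mult)
  also have "\<dots> = (c + round c) * odd_dfact (n - 1)"
    unfolding cA r[symmetric] by (simp add: distrib_right)
  also have "\<dots> \<le> \<beta> * odd_dfact (n - 1)"
    using of_int_round_le[of c] False \<beta> by (intro mult_right_mono) auto
  finally have d: "real (card ((A - \<Union>\<S>) \<union> (\<Union>\<S> - A))) \<le> \<beta> * odd_dfact (n - 1)" .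
  have "\<bar>c - round c\<bar> \<le> \<beta>"
    using of_int_round_abs_le[of c] False \<beta> by (simp add: abs_minus_commute)
  then show ?thesis using S r d by blast
qed

section \<open>The third moment of the projection\<close>

text \<open>Writing \<open>n\<close> as \<open>k + 3\<close> leaves room for deleting three disjoint
  edges, as the third moment demands. The parameter \<open>c\<close> measures \<open>A\<close> in
  units of the size of one star.\<close>

locale matching_family =
  fixes n k :: nat and A :: "nat set set set" and c :: real
  assumes n_eq: "n = Suc (Suc (Suc k))"
    and A_subset: "A \<subseteq> perfect_matchings n"
    and card_A: "real (card A) = c * real (odd_dfact (n - 1))"
begin

definition "W = {..<2 * n}"
abbreviation "V \<equiv> pm_on W"
abbreviation "E \<equiv> edges_on W"
lemma finite_W [simp]: "finite W" by (simp add: W_def)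

lemma perfect_matchings_V: "perfect_matchings n = V"
  by (simp add: perfect_matchings_eq_pm_on W_def)

lemma K_edges_E: "K_edges n = E"
  by (simp add: K_edges_eq_edges_on W_def)

definition "N = 2 * real n - 1"
text \<open>\<open>d1\<close>, \<open>d2\<close> and \<open>d3\<close> count the matchings through
  one, two and three given disjoint edges.\<close>

definition "d1 = real (odd_dfact (Suc (Suc k)))"
definition "d2 = real (odd_dfact (Suc k))"
definition "d3 = real (odd_dfact k)"
definition "b e = card {M \<in> A. e \<in> M} / d1"
definition "x e = b e - c / N"
text \<open>The factor that turns the star sums of \<open>sum x M\<close>, which are
  \<open>(d1 + d2) * x e\<close>, into \<open>d1 * x e\<close>, so that \<open>F\<close> has the
  same star sums as the indicator of \<open>A\<close>.\<close>

definition "\<kappa> = (N - 2) / (N - 1)"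
definition "F M = c / N + \<kappa> * sum x M"
definition "h M = indicator A M - F M"
definition "S = (\<Sum>e\<in>E. (x e)\<^sup>2)"
text \<open>\<open>S - T\<close> weighs each square by \<open>1 - b e\<close>. If it is small, most
  of the mass of \<open>x\<close> sits on edges whose density \<open>b e\<close> is near 1.\<close>

definition "T = (\<Sum>e\<in>E. (x e)\<^sup>2 * b e)"

section \<open>Double factorial ratios, star densities and row sums\<close>

lemma N_k: "N = 2 * real k + 5"
  unfolding N_def using n_eq by simp

lemma N_ge: "N \<ge> 5" by (simp add: N_k)

lemma d1_d2: "d1 = (N - 2) * d2"
  by (simp add: d1_def d2_def N_k odd_dfact_Suc[of "Suc k"] algebra_simps)

lemma d2_d3: "d2 = (N - 4) * d3"
  by (simp add: d2_def d3_def N_k odd_dfact_Suc[of k] algebra_simps)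

lemma d_pos: "d1 > 0" "d2 > 0" "d3 > 0"
  by (simp_all add: d1_def d2_def d3_def odd_dfact_pos)

lemma card_W: "card W = 2 * Suc (Suc (Suc k))" 
  unfolding W_def using n_eq by simp

lemma card_V: "real (card V) = N * d1"
proof -
  have "card V = odd_dfact (Suc (Suc (Suc k)))" using card_pm_on[OF _ card_W] by simp
  then show ?thesis
    by (simp add: d1_def N_k odd_dfact_Suc[of "Suc (Suc k)"] algebra_simps)
qed

lemma card_A_d1: "real (card A) = c * d1"
  using card_A by (simp add: d1_def n_eq)

lemma A_V: "A \<subseteq> V" using A_subset by (simp add: perfect_matchings_V)

lemma fin: "finite V" "finite A" "finite E"
  using finite_pm_on[OF finite_W] finite_subset[OF A_V] finite_edges_on[OF finite_W] by blast+

lemma c_nonneg: "c \<ge> 0"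
  using card_A_d1 d_pos(1) by (metis mult_less_0_iff not_less of_nat_0_le_iff)

lemma card_star: "e \<in> E \<Longrightarrow> card {M \<in> V. e \<in> M} = d1"
  unfolding d1_def using card_pm_on_containing[OF _ card_W] by simp

lemma b_nonneg: "b e \<ge> 0" using d_pos by (simp add: b_def)

lemma b_le_1:
  assumes "e \<in> E"
  shows "b e \<le> 1"
proof -
  have "card {M \<in> A. e \<in> M} \<le> card {M \<in> V. e \<in> M}"
    using A_V fin by (intro card_mono) auto
  then show ?thesis using card_star[OF assms] d_pos by (simp add: b_def)
qed

lemma b_le_c: "b e \<le> c"
proof -
  have "card {M \<in> A. e \<in> M} \<le> card A" using fin by (intro card_mono) auto
  then have "real (card {M \<in> A. e \<in> M}) \<le> c * d1" using card_A_d1 by linarith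
  then show ?thesis using d_pos by (simp add: b_def divide_le_eq)
qed

text \<open>Each matching of \<open>A\<close> contains exactly one edge at \<open>v\<close>, so the
  counts at \<open>v\<close> add up to \<open>card A\<close>.\<close>

lemma sum_b_at:
  assumes "v \<in> W"
  shows "(\<Sum>e | e \<in> E \<and> v \<in> e. b e) = c"
proof -
  have "(\<Sum>e\<in>{e \<in> E. v \<in> e}. \<Sum>M | M \<in> A \<and> e \<in> M. (1::nat)) =
      (\<Sum>M\<in>A. \<Sum>e | e \<in> {e \<in> E. v \<in> e} \<and> e \<in> M. 1)"
    by (rule sum.swap_restrict) (use fin in auto)
  also have "\<dots> = (\<Sum>M\<in>A. 1)"
  proof (intro sum.cong refl)
    fix M assume "M \<in> A"
    then have M: "M \<in> V" using A_V by auto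
    then have "{e. e \<in> {e \<in> E. v \<in> e} \<and> e \<in> M} = {e \<in> M. v \<in> e}" using pm_on_subset by blast
    then show "(\<Sum>e | e \<in> {e \<in> E. v \<in> e} \<and> e \<in> M. 1) = (1::nat)"
      using pm_on_unique_edge[OF M assms] by simp
  qed
  finally have "(\<Sum>e | e \<in> E \<and> v \<in> e. card {M \<in> A. e \<in> M}) = card A" by simp
  then have "(\<Sum>e | e \<in> E \<and> v \<in> e. b e) = card A / d1"
    unfolding b_def sum_divide_distrib[symmetric] of_nat_sum[symmetric] by simp
  then show ?thesis using card_A_d1 d_pos by simp
qed

lemma card_at: "v \<in> W \<Longrightarrow> real (card {e \<in> E. v \<in> e}) = N"
  using card_edges_at[of v W] by (simp add: N_k card_W)

lemma sum_x_at: "v \<in> W \<Longrightarrow> (\<Sum>e | e \<in> E \<and> v \<in> e. x e) = 0"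
  using sum_b_at card_at N_ge by (simp add: x_def sum_subtractf)

lemma sum_abs_x_at:
  assumes "v \<in> W"
  shows "(\<Sum>e | e \<in> E \<and> v \<in> e. \<bar>x e\<bar>) \<le> 2 * c"
proof -
  have "(\<Sum>e | e \<in> E \<and> v \<in> e. \<bar>x e\<bar>) \<le> (\<Sum>e | e \<in> E \<and> v \<in> e. b e + c / N)"
    by (intro sum_mono) (use b_nonneg c_nonneg N_ge in \<open>auto simp: x_def abs_le_iff intro: add_nonneg_nonneg\<close>)
  also have "\<dots> = 2 * c"
    using sum_b_at[OF assms] card_at[OF assms] N_ge by (simp add: sum.distrib)
  finally show ?thesis .
qed

lemma \<kappa>_bounds: "0 < \<kappa>" "\<kappa> < 1" "\<kappa> * (d1 + d2) = d1"
proof -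
  show "0 < \<kappa>" "\<kappa> < 1" using N_ge by (simp_all add: \<kappa>_def)
  show "\<kappa> * (d1 + d2) = d1" using N_ge by (simp add: \<kappa>_def d1_d2 field_simps)
qed

section \<open>Orthogonality of the residual and second moments\<close>

lemma sum_V_x: "(\<Sum>M\<in>V. sum x M) = 0"
  using sum_pm_on_first_moment[OF _ card_W, of x] sum_edges_on_degree[of W x] sum_x_at by simp

lemma sum_V_x_square: "\<kappa> * (\<Sum>M\<in>V. (sum x M)\<^sup>2) = d1 * S"
  using second_moment_zero_rows[OF _ card_W sum_x_at] \<kappa>_bounds(3)
  by (simp add: S_def d1_def d2_def mult.assoc[symmetric])

text \<open>The choice of \<open>\<kappa>\<close> equalises the sums of \<open>F\<close> and of the
  indicator of \<open>A\<close> over each star, which makes \<open>h\<close> orthogonal to every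
  star.\<close>

lemma sum_h_star:
  assumes "e \<in> E"
  shows "(\<Sum>M | M \<in> V \<and> e \<in> M. h M) = 0"
proof -
  have A: "(\<Sum>M | M \<in> V \<and> e \<in> M. indicator A M) = d1 * b e"
  proof -
    have "{M. M \<in> V \<and> e \<in> M} \<inter> A = {M \<in> A. e \<in> M}" using A_V by auto
    then show ?thesis
      using sum_mult_indicator[of "{M. M \<in> V \<and> e \<in> M}" "\<lambda>_. 1 :: real" A] fin d_pos
      by (simp add: b_def)
  qed
  have "(\<Sum>M | M \<in> V \<and> e \<in> M. sum x M) = d1 * x e + d2 * x e"
    using sum_pm_on_containing_first_moment[OF _ card_W assms, of x]
      sum_edges_on_diff_edge[OF _ assms sum_x_at] by (simp add: d1_def d2_def)
  then have "(\<Sum>M | M \<in> V \<and> e \<in> M. F M) = d1 * (c / N) + (\<kappa> * (d1 + d2)) * x e"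
    by (simp add: F_def sum.distrib sum_distrib_left[symmetric] card_star[OF assms] algebra_simps)
  also have "\<dots> = d1 * b e" unfolding \<kappa>_bounds(3) x_def by (simp add: algebra_simps)
  finally show ?thesis using A by (simp add: h_def sum_subtractf)
qed

lemma card_V_member: "M \<in> V \<Longrightarrow> card M = n"
  using card_pm_on_member[of W M] by (simp add: W_def)

text \<open>Spreading the constant \<open>c / N\<close> evenly over the \<open>n\<close> edges of a
  matching displays \<open>F\<close> as a linear combination of star indicators.\<close>

lemma F_eq_sum:
  assumes "M \<in> V"
  shows "F M = (\<Sum>e\<in>M. \<kappa> * x e + c / (N * n))"
proof -
  have "real n > 0" by (simp add: n_eq)
  then show ?thesis using card_V_member[OF assms]
    by (simp add: F_def sum.distrib sum_distrib_left)
qed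

lemma sum_h_F: "(\<Sum>M\<in>V. h M * F M) = 0"
proof -
  have "(\<Sum>M\<in>V. h M * F M) = (\<Sum>M\<in>V. \<Sum>e | e \<in> E \<and> e \<in> M. h M * (\<kappa> * x e + c / (N * n)))"
  proof (intro sum.cong refl)
    fix M assume M: "M \<in> V"
    then have "{e. e \<in> E \<and> e \<in> M} = M" using pm_on_subset by blast
    then show "h M * F M = (\<Sum>e | e \<in> E \<and> e \<in> M. h M * (\<kappa> * x e + c / (N * n)))"
      using F_eq_sum[OF M] by (simp add: sum_distrib_left)
  qed
  also have "\<dots> = (\<Sum>e\<in>E. \<Sum>M | M \<in> V \<and> e \<in> M. h M * (\<kappa> * x e + c / (N * n)))"
    using fin by (intro sum.swap_restrict) auto
  also have "\<dots> = 0"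
    by (rule sum.neutral, rule ballI) (simp add: sum_distrib_right[symmetric] sum_h_star)
  finally show ?thesis .
qed

lemma sum_V_indicator: "(\<Sum>M\<in>V. indicator A M * \<phi> M) = (\<Sum>M\<in>A. \<phi> M :: real)"
  using A_V fin by (simp add: sum_indicator_mult Int_absorb1)

lemma sum_A_h: "(\<Sum>M\<in>A. h M) = (\<Sum>M\<in>V. (h M)\<^sup>2)"
proof -
  have "(\<Sum>M\<in>V. (h M)\<^sup>2) = (\<Sum>M\<in>V. indicator A M * h M - h M * F M)"
    by (intro sum.cong refl) (simp add: h_def power2_eq_square algebra_simps)
  then show ?thesis by (simp add: sum_subtractf sum_h_F sum_V_indicator)
qed

lemma sum_F_square: "(\<Sum>M\<in>V. (F M)\<^sup>2) = d1 * (c\<^sup>2 / N + \<kappa> * S)"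
proof -
  have "(\<Sum>M\<in>V. (F M)\<^sup>2) =
      (\<Sum>M\<in>V. (c / N)\<^sup>2 + 2 * (c / N) * \<kappa> * sum x M + \<kappa> * (\<kappa> * (sum x M)\<^sup>2))"
    by (intro sum.cong refl) (simp add: F_def power2_eq_square algebra_simps)
  also have "\<dots> = N * d1 * (c / N)\<^sup>2 + \<kappa> * (d1 * S)"
    by (simp only: sum.distrib sum_distrib_left[symmetric] sum_V_x sum_V_x_square)
      (simp add: card_V)
  finally show ?thesis using N_ge by (simp add: power2_eq_square algebra_simps)
qed

text \<open>Pythagoras: the sum of squares of \<open>F\<close> is at most that of the indicator of
  \<open>A\<close>, which is \<open>c * d1\<close>.\<close>

lemma S_bound: "\<kappa> * S \<le> c - c\<^sup>2 / N"
proof -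
  have "(\<Sum>M\<in>V. (F M)\<^sup>2) = (\<Sum>M\<in>V. indicator A M - indicator A M * h M - h M * F M)"
    by (intro sum.cong refl) (auto simp: h_def power2_eq_square algebra_simps indicator_def)
  also have "\<dots> = c * d1 - (\<Sum>M\<in>V. (h M)\<^sup>2)"
    using sum_V_indicator[of "\<lambda>_. 1"] card_A_d1
    by (simp add: sum_subtractf sum_h_F sum_V_indicator sum_A_h)
  also have "\<dots> \<le> c * d1" by (simp add: sum_nonneg)
  finally have "d1 * (c\<^sup>2 / N + \<kappa> * S) \<le> d1 * c" 
    by (simp only: sum_F_square mult.commute)
  then show ?thesis using d_pos by simp
qed

text \<open>Each of the \<open>n\<close> edges contributes at least \<open>- (c / N)\<close> to
  \<open>sum x M\<close>, while \<open>n \<le> N\<close> and \<open>\<kappa> < 1\<close>.\<close>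

lemma F_lower:
  assumes "M \<in> V"
  shows "- c \<le> F M"
proof -
  have "sum x M \<ge> (\<Sum>e\<in>M. - (c / N))"
    by (intro sum_mono) (simp add: x_def b_nonneg)
  then have "sum x M \<ge> - (c / N * n)" by (simp add: card_V_member[OF assms] mult.commute)
  moreover have "c / N * n \<le> c"
  proof -
    have "n \<le> N" using N_ge by (simp add: N_def)
    then show ?thesis using c_nonneg N_ge by (simp add: divide_le_eq mult_left_mono)
  qed
  ultimately have s: "sum x M \<ge> - c" by linarith
  have "\<kappa> * sum x M \<ge> \<kappa> * - c" using s \<kappa>_bounds by (intro mult_left_mono) auto
  moreover have "\<kappa> * c \<le> c" using c_nonneg \<kappa>_bounds by (simp add: mult_left_le_one_le)
  moreover have "c / N \<ge> 0" using c_nonneg N_ge by simp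
  ultimately show ?thesis by (simp add: F_def)
qed

lemma sum_F_cube_lower: "c * d1 - (3 + c) * (\<Sum>M\<in>V. (h M)\<^sup>2) \<le> (\<Sum>M\<in>V. F M ^ 3)"
proof -
  \<comment> \<open>Here \<open>F = 1 - h\<close> on \<open>A\<close> and \<open>F = - h\<close> off
    \<open>A\<close>; in both cases the difference of the two sides is \<open>h\<^sup>2\<close>
    times a quantity that \<open>F \<ge> - c\<close> keeps nonnegative.\<close>
  have "indicator A M * (1 - 3 * h M) - c * (h M)\<^sup>2 \<le> F M ^ 3" if M: "M \<in> V" for M
  proof (cases "M \<in> A")
    case True
    then have F: "F M = 1 - h M" by (simp add: h_def)
    have "F M ^ 3 - (1 - 3 * h M) + c * (h M)\<^sup>2 = (h M)\<^sup>2 * (2 + (F M + c))"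
      unfolding F by (simp add: power2_eq_square power3_eq_cube algebra_simps)
    also have "\<dots> \<ge> 0" using F_lower[OF M] by (intro mult_nonneg_nonneg) auto
    finally show ?thesis using True by simp
  next
    case False
    then have F: "F M = - h M" by (simp add: h_def)
    have "F M ^ 3 + c * (h M)\<^sup>2 = (h M)\<^sup>2 * (F M + c)"
      unfolding F by (simp add: power2_eq_square power3_eq_cube algebra_simps)
    also have "\<dots> \<ge> 0" using F_lower[OF M] by (intro mult_nonneg_nonneg) auto
    finally show ?thesis using False by simp
  qed
  then have "(\<Sum>M\<in>V. indicator A M * (1 - 3 * h M) - c * (h M)\<^sup>2) \<le> (\<Sum>M\<in>V. F M ^ 3)"
    by (rule sum_mono)
  moreover have "(\<Sum>M\<in>V. indicator A M * (1 - 3 * h M) - c * (h M)\<^sup>2) =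
      c * d1 - (3 + c) * (\<Sum>M\<in>V. (h M)\<^sup>2)"
    unfolding sum_subtractf sum_V_indicator sum_distrib_left[symmetric] sum_A_h
    by (simp add: card_A_d1 distrib_right)
  ultimately show ?thesis by simp
qed

lemma S_nonneg: "S \<ge> 0" by (simp add: S_def sum_nonneg)

lemma T_nonneg: "T \<ge> 0" by (simp add: T_def sum_nonneg b_nonneg)

text \<open>Expansion around the mean \<open>c / N\<close>: the linear term vanishes,
  \<open>\<kappa> * S \<le> c\<close> bounds the quadratic one, the cubes give \<open>T\<close>, and
  the last summand bounds the remainder, where \<open>d1 = (N - 2) * (N - 4) * d3\<close>.\<close>

lemma sum_F_cube_upper:
  "(\<Sum>M\<in>V. F M ^ 3) \<le>
    d1 * (c ^ 3 / N\<^sup>2 + 3 * c\<^sup>2 / N + T + 6 * c * (N + 1) * S / ((N - 2) * (N - 4)))"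
proof -
  define R where "R = (\<Sum>e\<in>E. \<Sum>f\<in>edges_on (W - e). x e * x f * sum x (edges_on (e \<union> f)))"
  define S3 where "S3 = (\<Sum>e\<in>E. x e ^ 3)"
  have moment: "(\<Sum>M\<in>V. (sum x M) ^ 3) = (d1 + 3 * d2) * S3 + d3 * R"
    using third_moment_zero_rows[OF _ card_W sum_x_at]
    by (simp add: d1_def d2_def d3_def R_def S3_def)
  have "\<bar>R\<bar> \<le> 3 * (2 * c) * card W * S"
    unfolding R_def S_def by (intro third_moment_remainder_bound sum_abs_x_at) auto
  \<comment> \<open>The row sums of absolute values are at most \<open>2 * c\<close>, and
    \<open>card W = N + 1\<close>.\<close>
  then have R: "R \<le> 6 * c * (N + 1) * S" by (simp add: N_def W_def algebra_simps)
  have S3: "S3 \<le> T"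
    unfolding S3_def T_def
  proof (rule sum_mono)
    fix e
    have "x e \<le> b e" using c_nonneg N_ge by (simp add: x_def)
    then show "x e ^ 3 \<le> (x e)\<^sup>2 * b e"
      by (simp add: power3_eq_cube power2_eq_square mult_left_mono)
  qed
  have \<kappa>3: "0 \<le> \<kappa> ^ 3" "\<kappa> ^ 3 \<le> 1" using \<kappa>_bounds by (auto intro: power_le_one)
  \<comment> \<open>In units of \<open>d2\<close> this reads
    \<open>\<kappa> ^ 3 * (N + 1) \<le> N - 2\<close>. The shrinking by \<open>\<kappa>\<close> thus
    absorbs the extra \<open>3 * d2\<close> of the third moment and leaves \<open>T\<close> with
    coefficient \<open>1\<close>.\<close>
  have coef: "\<kappa> ^ 3 * (d1 + 3 * d2) \<le> d1"
  proof -
    have "(N - 2) ^ 2 * (N + 1) \<le> (N - 1) ^ 3"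
      using N_ge by (simp add: power2_eq_square power3_eq_cube algebra_simps)
    then have "(N - 2) * ((N - 2) ^ 2 * (N + 1)) \<le> (N - 2) * (N - 1) ^ 3"
      using N_ge by (intro mult_left_mono) auto
    then have "\<kappa> ^ 3 * (N + 1) \<le> N - 2"
      using N_ge by (simp add: \<kappa>_def power_divide divide_le_eq power3_eq_cube power2_eq_square mult_ac)
    then have "\<kappa> ^ 3 * (N + 1) * d2 \<le> (N - 2) * d2"
      using d_pos by (intro mult_right_mono) auto
    then show ?thesis by (simp add: d1_d2 algebra_simps)
  qed
  have "\<kappa> ^ 3 * ((d1 + 3 * d2) * S3) \<le> \<kappa> ^ 3 * ((d1 + 3 * d2) * T)"
    using \<kappa>3 d_pos S3 by (intro mult_left_mono) auto
  also have "\<dots> \<le> d1 * T"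
    using mult_right_mono[OF coef T_nonneg] by (simp add: mult.assoc)
  finally have main: "\<kappa> ^ 3 * ((d1 + 3 * d2) * S3) \<le> d1 * T" .
  have "\<kappa> ^ 3 * (d3 * R) \<le> \<kappa> ^ 3 * (d3 * (6 * c * (N + 1) * S))"
    using \<kappa>3 d_pos R by (intro mult_left_mono) auto
  also have "\<dots> \<le> 1 * (d3 * (6 * c * (N + 1) * S))"
    using \<kappa>3 d_pos c_nonneg S_nonneg N_ge by (intro mult_right_mono) auto
  also have "\<dots> = d1 * (6 * c * (N + 1) * S / ((N - 2) * (N - 4)))"
    using N_ge by (simp add: d1_d2 d2_d3)
  finally have rest: "\<kappa> ^ 3 * (d3 * R) \<le> d1 * (6 * c * (N + 1) * S / ((N - 2) * (N - 4)))" .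
  have "\<kappa> * S \<le> c" using S_bound c_nonneg N_ge
    by (smt (verit) divide_nonneg_nonneg zero_le_power2)
  then have "3 * (c / N) * (\<kappa> * S) \<le> 3 * (c / N) * c"
    using c_nonneg N_ge by (intro mult_left_mono) auto
  then have quad: "3 * (c / N) * (\<kappa> * (d1 * S)) \<le> d1 * (3 * c\<^sup>2 / N)"
    using d_pos mult_left_mono[of "3 * (c / N) * (\<kappa> * S)" "3 * (c / N) * c" d1]
    by (simp add: power2_eq_square mult_ac)
  have cube: "(m + \<kappa> * s) ^ 3 = m ^ 3 + 3 * m\<^sup>2 * \<kappa> * s + 3 * m * \<kappa> * (\<kappa> * s\<^sup>2) + \<kappa> ^ 3 * s ^ 3" for m s
    by (simp add: power2_eq_square power3_eq_cube algebra_simps)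
  have "(\<Sum>M\<in>V. F M ^ 3) = (\<Sum>M\<in>V. (c / N) ^ 3 + 3 * (c / N)\<^sup>2 * \<kappa> * sum x M
      + 3 * (c / N) * \<kappa> * (\<kappa> * (sum x M)\<^sup>2) + \<kappa> ^ 3 * (sum x M) ^ 3)"
    unfolding F_def cube ..
  also have "\<dots> = N * d1 * (c / N) ^ 3 + 3 * (c / N) * (\<kappa> * (d1 * S))
      + \<kappa> ^ 3 * ((d1 + 3 * d2) * S3 + d3 * R)"
    by (simp only: sum.distrib mult.assoc sum_distrib_left[symmetric] sum_V_x sum_V_x_square moment)
      (simp add: card_V)
  also have "N * d1 * (c / N) ^ 3 = d1 * (c ^ 3 / N\<^sup>2)"
    using N_ge by (simp add: power2_eq_square power3_eq_cube)
  finally show ?thesis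
    using main rest quad by (simp add: distrib_left)
qed

text \<open>On matchings \<open>F\<close> coincides with an explicit combination of star indicators,
  and the zero star sums of \<open>h\<close> are the orthogonality required of the
  projection.\<close>

lemma Proj_eq_F: "M \<in> V \<Longrightarrow> Proj n (star_span n) (indicator A) M = F M"
proof -
  let ?G = "\<Sum>e\<in>K_edges n. fun_scale (\<kappa> * x e + c / (N * n)) (indicator (star n e))"
  have G: "?G M = F M" if M: "M \<in> V" for M
  proof -
    have "?G M = (\<Sum>e\<in>E. (\<kappa> * x e + c / (N * n)) * indicator M e)"
      unfolding sum_fun_scale_apply K_edges_E
      using M by (intro sum.cong refl) (auto simp: star_def perfect_matchings_V indicator_def)
    also have "\<dots> = (\<Sum>e\<in>M. \<kappa> * x e + c / (N * n))"
      using pm_on_subset[OF M] fin by (simp add: sum_mult_indicator Int_absorb1)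
    finally show ?thesis using F_eq_sum[OF M] by simp
  qed
  have "Proj n (star_span n) (indicator A) = ?G"
  proof (rule Proj_star_span_eqI[OF star_span_combination])
    fix e assume "e \<in> K_edges n"
    then have e: "e \<in> E" by (simp add: K_edges_E)
    have "(\<Sum>M\<in>V. (indicator A - ?G) M * indicator (star n e) M) = (\<Sum>M\<in>V. h M * indicator {M \<in> V. e \<in> M} M)"
    proof (intro sum.cong refl)
      fix M assume "M \<in> V"
      then have "(indicator A - ?G) M = h M" using G[of M] by (simp add: h_def)
      then show "(indicator A - ?G) M * indicator (star n e) M = h M * indicator {M \<in> V. e \<in> M} M"
        by (simp only: star_def perfect_matchings_V)
    qed
    also have "\<dots> = (\<Sum>M | M \<in> V \<and> e \<in> M. h M)"
    proof -
      have "V \<inter> {M \<in> V. e \<in> M} = {M. M \<in> V \<and> e \<in> M}" by auto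
      then show ?thesis using fin by (simp add: sum_mult_indicator)
    qed
    finally show "pm_inner n (indicator A - ?G) (indicator (star n e)) = 0"
      using sum_h_star[OF e] by (simp add: pm_inner_def perfect_matchings_V)
  qed
  then show "M \<in> V \<Longrightarrow> Proj n (star_span n) (indicator A) M = F M" using G by simp
qed

lemma pm_norm_eq:
  "(pm_norm n (indicator A - Proj n (star_span n) (indicator A)))\<^sup>2 = (\<Sum>M\<in>V. (h M)\<^sup>2) / (N * d1)"
proof -
  have "(\<Sum>M\<in>V. ((indicator A - Proj n (star_span n) (indicator A)) M)\<^sup>2) = (\<Sum>M\<in>V. (h M)\<^sup>2)"
    by (intro sum.cong refl) (simp add: Proj_eq_F h_def)
  moreover have "0 \<le> (\<Sum>M\<in>V. (h M)\<^sup>2) / (N * d1)"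
    using N_ge d_pos by (intro divide_nonneg_nonneg sum_nonneg) auto
  ultimately show ?thesis
    by (simp add: pm_norm_def perfect_matchings_V card_V)
qed

section \<open>Sizes and overlaps of stars\<close>

lemma card_stars_inter:
  assumes "e \<in> E" "f \<in> E" "e \<noteq> f"
  shows "card (star n e \<inter> star n f) \<le> d2"
proof (cases "f \<in> edges_on (W - e)")
  case True
  have "card (star n e \<inter> star n f) = (\<Sum>M | M \<in> V \<and> e \<in> M. if f \<in> M then 1 else 0)"
    using fin by (simp add: sum.inter_filter[symmetric] star_def perfect_matchings_V Int_def conj_ac)
  also have "\<dots> = (\<Sum>M\<in>pm_on (W - e). if f \<in> insert e M then 1 else 0)"
    by (rule sum_pm_on_containing[OF assms(1)])
  also have "\<dots> = card {M \<in> pm_on (W - e). f \<in> M}"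
    using assms(3) finite_pm_on[of "W - e"] by (simp add: sum.inter_filter[symmetric])
  also have "\<dots> = odd_dfact (Suc k)"
    using card_pm_on_containing[OF _ card_edges_on_diff[OF finite_W assms(1) card_W] True] by simp
  finally show ?thesis by (simp add: d2_def)
next
  case False
  then have "e \<inter> f \<noteq> {}" using assms by (auto simp: edges_on_def)
  then have "star n e \<inter> star n f = {}"
    using pm_on_disjoint[of _ W e f] assms(3) by (auto simp: star_def perfect_matchings_V)
  then show ?thesis using d_pos by simp
qed

text \<open>Two different edges share at most \<open>d2\<close> matchings, fewer than the
  \<open>d1 = (N - 2) * d2\<close> of a single star. Counting stars is therefore counting
  edges.\<close>

lemma inj_on_star: "N > 3 \<Longrightarrow> inj_on (star n) E"
proof (rule inj_onI, rule ccontr)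
  fix e f assume *: "N > 3" "e \<in> E" "f \<in> E" "star n e = star n f" "e \<noteq> f"
  have "d1 = card (star n e)" using card_star[OF *(2)] by (simp add: star_def perfect_matchings_V)
  also have "\<dots> \<le> d2" using card_stars_inter[OF *(2,3,5)] *(4) by simp
  finally have "(N - 2) * d2 \<le> 1 * d2" by (simp add: d1_d2)
  then show False using d_pos *(1) by (simp add: mult_le_cancel_right)
qed

lemma card_star_diff:
  assumes "e \<in> E"
  shows "card (star n e - A) = d1 * (1 - b e)"
proof -
  have "real (card (star n e - A)) = real (card (star n e)) - real (card (star n e \<inter> A))"
    using card_Diff_subset_Int[of "star n e" A] finite_star card_mono[of "star n e" "star n e \<inter> A"]
    by (simp add: of_nat_diff)
  also have "star n e \<inter> A = {M \<in> A. e \<in> M}"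
    using A_V by (auto simp: star_def perfect_matchings_V)
  also have "real (card (star n e)) = d1"
    using card_star[OF assms] by (simp add: star_def perfect_matchings_V)
  finally show ?thesis using d_pos by (simp add: b_def algebra_simps)
qed

section \<open>Bounds on \<open>S\<close> and \<open>T\<close> when the distance is small\<close>

lemma T_lower:
  assumes "(\<Sum>M\<in>V. (h M)\<^sup>2) \<le> \<epsilon> * c * d1"
  shows "c - (3 + c) * c * \<epsilon> - c ^ 3 / N\<^sup>2 - 3 * c\<^sup>2 / N - 6 * c * (N + 1) * S / ((N - 2) * (N - 4)) \<le> T"
proof -
  have "(3 + c) * (\<Sum>M\<in>V. (h M)\<^sup>2) \<le> (3 + c) * (\<epsilon> * c * d1)"
    using assms c_nonneg by (intro mult_left_mono) auto
  then have "c * d1 - (3 + c) * (\<epsilon> * c * d1) \<le>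
      d1 * (c ^ 3 / N\<^sup>2 + 3 * c\<^sup>2 / N + T + 6 * c * (N + 1) * S / ((N - 2) * (N - 4)))"
    using sum_F_cube_lower sum_F_cube_upper by linarith
  then have "d1 * (c - (3 + c) * c * \<epsilon>) \<le>
      d1 * (c ^ 3 / N\<^sup>2 + 3 * c\<^sup>2 / N + T + 6 * c * (N + 1) * S / ((N - 2) * (N - 4)))"
    by (simp only: right_diff_distrib mult_ac)
  then show ?thesis using d_pos by simp
qed

text \<open>\<open>1 / \<kappa> = 1 + 1 / (N - 2)\<close>, and
  \<open>N / (N - 2) \<le> 7 / 5\<close> for \<open>N \<ge> 7\<close>.\<close>

lemma S_upper:
  assumes "N \<ge> 7"
  shows "S \<le> c + 7 / 5 * (c / N)"
proof -
  have "\<kappa> * S \<le> c" using S_bound N_ge by (smt (verit) divide_nonneg_nonneg zero_le_power2)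
  moreover have "c \<le> \<kappa> * (c + 7 / 5 * (c / N))"
  proof -
    have "1 \<le> \<kappa> * (1 + 7 / 5 / N)"
      using assms by (simp add: \<kappa>_def field_simps)
    then have "c * 1 \<le> c * (\<kappa> * (1 + 7 / 5 / N))" using c_nonneg by (rule mult_left_mono)
    then show ?thesis by (simp add: algebra_simps)
  qed
  ultimately have "\<kappa> * S \<le> \<kappa> * (c + 7 / 5 * (c / N))" by linarith
  then show ?thesis using \<kappa>_bounds by simp
qed

text \<open>The coefficient \<open>34\<close> is \<open>30\<close> from the third-moment remainder,
  \<open>3\<close> from the quadratic term and \<open>1\<close> from the cube of the mean.\<close>

lemma T_lower_simple:
  assumes "(\<Sum>M\<in>V. (h M)\<^sup>2) \<le> \<epsilon> * c * d1" "N \<ge> 7" "c \<le> N"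
  shows "c - 3 * c * \<epsilon> - c\<^sup>2 * \<epsilon> - 34 * (c\<^sup>2 / N) \<le> T"
proof -
  have "c / N \<le> c / 7" using assms c_nonneg by (intro divide_left_mono) auto
  then have S: "S \<le> 6 / 5 * c" using S_upper[OF assms(2)] by linarith
  have pos: "0 < (N - 2) * (N - 4)" using assms by (intro mult_pos_pos) auto
  have "0 \<le> (N - 7) * (N - 7)" by simp
  then have "36 * ((N + 1) * N) \<le> 150 * ((N - 2) * (N - 4))"
    using assms by (simp add: algebra_simps)
  \<comment> \<open>The factor \<open>36 / 5\<close> is \<open>6\<close> times the
    \<open>6 / 5\<close> from the bound on \<open>S\<close>.\<close>
  then have q: "36 / 5 * (N + 1) / ((N - 2) * (N - 4)) \<le> 30 / N"
    using assms(2) by (simp add: field_simps)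
  have "6 * c * (N + 1) * S / ((N - 2) * (N - 4)) \<le> 6 * c * (N + 1) * (6 / 5 * c) / ((N - 2) * (N - 4))"
    using S pos c_nonneg assms by (intro divide_right_mono mult_left_mono) auto
  also have "\<dots> = c\<^sup>2 * (36 / 5 * (N + 1) / ((N - 2) * (N - 4)))"
    by (simp add: power2_eq_square)
  also have "\<dots> \<le> c\<^sup>2 * (30 / N)" by (intro mult_left_mono q) auto
  finally have r: "6 * c * (N + 1) * S / ((N - 2) * (N - 4)) \<le> 30 * (c\<^sup>2 / N)"
    by (simp add: mult.commute)
  have "c ^ 3 / N\<^sup>2 = c / N * (c\<^sup>2 / N)" by (simp add: power2_eq_square power3_eq_cube)
  also have "\<dots> \<le> 1 * (c\<^sup>2 / N)"
    using assms by (intro mult_right_mono) auto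
  finally have "c ^ 3 / N\<^sup>2 \<le> c\<^sup>2 / N" by simp
  moreover have "(3 + c) * c * \<epsilon> = 3 * c * \<epsilon> + c\<^sup>2 * \<epsilon>" "3 * c\<^sup>2 / N = 3 * (c\<^sup>2 / N)"
    by (simp_all add: power2_eq_square distrib_right)
  ultimately show ?thesis using T_lower[OF assms(1)] r by linarith
qed

text \<open>If \<open>c < 1 / 2\<close>, all densities are at most \<open>c\<close>, so
  \<open>T \<le> c * S \<le> 6 / 5 * c\<^sup>2\<close>, which is below \<open>3 / 5 * c\<close> and
  contradicts the lower bound on \<open>T\<close>. Afterwards \<open>c \<le> 2 * c\<^sup>2\<close>,
  so errors linear in \<open>c\<close> fit a quadratic bound.\<close>

lemma c_ge_half:
  assumes "(\<Sum>M\<in>V. (h M)\<^sup>2) \<le> \<epsilon> * c * d1" "N \<ge> 7" "c / N \<le> 1 / 10000" "0 < c" "0 \<le> \<epsilon>" "\<epsilon> \<le> 1 / 100"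
  shows "c \<ge> 1 / 2"
proof (rule ccontr)
  assume "\<not> c \<ge> 1 / 2"
  then have c: "c < 1 / 2" by simp
  have S: "S \<le> 6 / 5 * c"
  proof -
    have "c / N \<le> c / 7" using assms by (intro divide_left_mono) auto
    then show ?thesis using S_upper[OF assms(2)] by linarith
  qed
  have "T \<le> (\<Sum>e\<in>E. (x e)\<^sup>2 * c)"
    unfolding T_def by (intro sum_mono mult_left_mono b_le_c) auto
  also have "\<dots> = c * S" by (simp add: S_def sum_distrib_left mult.commute)
  also have "\<dots> \<le> c * (6 / 5 * c)" using S assms by (intro mult_left_mono) auto
  finally have T: "T \<le> c * (6 / 5 * c)" .
  have "c \<le> N" using c assms by simp
  then have "c - 3 * c * \<epsilon> - c\<^sup>2 * \<epsilon> - 34 * (c\<^sup>2 / N) \<le> c * (6 / 5 * c)"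
    using T_lower_simple[OF assms(1,2)] T by linarith
  then have "c * (1 - 3 * \<epsilon> - c * \<epsilon> - 34 * (c / N)) \<le> c * (6 / 5 * c)"
    by (simp add: power2_eq_square algebra_simps)
  then have *: "1 - 3 * \<epsilon> - c * \<epsilon> - 34 * (c / N) \<le> 6 / 5 * c" using assms(4) by simp
  have "c * \<epsilon> \<le> 1 * (1 / 100)" using c assms by (intro mult_mono) auto
  then show False using * c assms by linarith
qed

section \<open>Approximation by stars\<close>

text \<open>The heavy edges. The threshold \<open>1 / 2\<close> keeps \<open>1 - b e\<close> away
  from zero off \<open>E1\<close> and, once \<open>c / N\<close> is small, \<open>x e\<close> away
  from zero on it.\<close>

definition "E1 = {e \<in> E. 1 / 2 \<le> b e}"

lemma E1_subset: "E1 \<subseteq> E" "finite E1"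
  using fin by (auto simp: E1_def)

lemma S_minus_T: "S - T = (\<Sum>e\<in>E. (x e)\<^sup>2 * (1 - b e))"
  by (simp add: S_def T_def right_diff_distrib sum_subtractf)

text \<open>A heavy edge has \<open>x e \<ge> 1 / 4\<close>, hence its deficiency
  \<open>1 - b e\<close> is at most \<open>16\<close> times its term in
  \<open>S - T\<close>.\<close>

lemma deficiency_E1:
  assumes "c / N \<le> 1 / 4"
  shows "(\<Sum>e\<in>E1. 1 - b e) \<le> 16 * (S - T)"
proof -
  have "(\<Sum>e\<in>E1. (1 - b e) / 16) \<le> (\<Sum>e\<in>E1. (x e)\<^sup>2 * (1 - b e))"
  proof (rule sum_mono)
    fix e assume "e \<in> E1"
    then have e: "e \<in> E" "1 / 2 \<le> b e" by (auto simp: E1_def)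
    then have "1 / 4 \<le> x e" using assms by (simp add: x_def)
    then have "(1 / 4)\<^sup>2 \<le> (x e)\<^sup>2" by (intro power_mono) auto
    then have "(1 / 4)\<^sup>2 * (1 - b e) \<le> (x e)\<^sup>2 * (1 - b e)"
      using b_le_1[OF e(1)] by (intro mult_right_mono) auto
    then show "(1 - b e) / 16 \<le> (x e)\<^sup>2 * (1 - b e)" by (simp add: power2_eq_square)
  qed
  also have "\<dots> \<le> S - T"
    unfolding S_minus_T using E1_subset fin b_le_1 by (intro sum_mono2) auto
  finally show ?thesis by (simp add: sum_divide_distrib[symmetric])
qed

lemma mass_outside_E1: "(\<Sum>e\<in>E - E1. (x e)\<^sup>2) \<le> 2 * (S - T)"
proof -
  have "(\<Sum>e\<in>E - E1. (x e)\<^sup>2) \<le> (\<Sum>e\<in>E - E1. 2 * ((x e)\<^sup>2 * (1 - b e)))"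
  proof (rule sum_mono)
    fix e assume "e \<in> E - E1"
    then have "1 / 2 \<le> 1 - b e" by (auto simp: E1_def)
    then have "(x e)\<^sup>2 * (1 / 2) \<le> (x e)\<^sup>2 * (1 - b e)" by (intro mult_left_mono) auto
    then show "(x e)\<^sup>2 \<le> 2 * ((x e)\<^sup>2 * (1 - b e))" by simp
  qed
  also have "\<dots> \<le> (\<Sum>e\<in>E. 2 * ((x e)\<^sup>2 * (1 - b e)))"
    using fin b_le_1 by (intro sum_mono2) auto
  also have "\<dots> = 2 * (S - T)" by (simp add: S_minus_T sum_distrib_left)
  finally show ?thesis .
qed

lemma S_split: "S = (\<Sum>e\<in>E1. (x e)\<^sup>2) + (\<Sum>e\<in>E - E1. (x e)\<^sup>2)"
  unfolding S_def using sum.subset_diff[OF E1_subset(1) fin(3), of "\<lambda>e. (x e)\<^sup>2"] by simp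

text \<open>Each heavy edge carries mass at most \<open>1\<close>, and at most
  \<open>2 * (S - T)\<close> of the total mass \<open>S\<close> lies on the other edges.\<close>

lemma card_E1_lower:
  assumes "c / N \<le> 1 / 4"
  shows "S - 2 * (S - T) \<le> card E1"
proof -
  have "(\<Sum>e\<in>E1. (x e)\<^sup>2) \<le> (\<Sum>e\<in>E1. 1)"
  proof (rule sum_mono)
    fix e assume "e \<in> E1"
    then have "0 \<le> b e" "b e \<le> 1" using b_nonneg b_le_1 E1_subset by auto
    moreover have "0 \<le> c / N" using c_nonneg N_ge by simp
    ultimately have "\<bar>x e\<bar> \<le> 1" unfolding x_def abs_le_iff using assms by linarith
    then show "(x e)\<^sup>2 \<le> 1" by (simp add: abs_square_le_1)
  qed
  then show ?thesis using S_split mass_outside_E1 by simp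
qed

text \<open>Since \<open>1 - (x e)\<^sup>2 \<le> 2 * (1 - x e)\<close>, a heavy edge carries mass
  \<open>1\<close> up to its deficiency and a multiple of \<open>c / N\<close>. The latter occurs
  \<open>card E1\<close> times, which is why the crude bound \<open>16 * S\<close> comes
  first.\<close>

lemma card_E1_upper:
  assumes "c / N \<le> 1 / 4"
  shows "card E1 \<le> S + 32 * (S - T) + 32 * S * (c / N)"
proof -
  have cN: "0 \<le> c / N" using c_nonneg N_ge by simp
  have x_E1: "1 / 4 \<le> x e" "x e \<le> 1" if "e \<in> E1" for e
    using that assms b_le_1[of e] cN by (auto simp: E1_def x_def)
  have mass: "(\<Sum>e\<in>E1. (x e)\<^sup>2) \<le> S"
    using S_split by (simp add: sum_nonneg)
  have "(\<Sum>e\<in>E1. 1 / 16) \<le> (\<Sum>e\<in>E1. (x e)\<^sup>2)"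
  proof (rule sum_mono)
    fix e assume "e \<in> E1"
    then have "(1 / 4)\<^sup>2 \<le> (x e)\<^sup>2" using x_E1 by (intro power_mono) auto
    then show "1 / 16 \<le> (x e)\<^sup>2" by (simp add: power2_eq_square)
  qed
  then have crude: "card E1 \<le> 16 * S" using mass by simp
  have "(\<Sum>e\<in>E1. 1) \<le> (\<Sum>e\<in>E1. (x e)\<^sup>2 + 2 * (1 - b e) + 2 * (c / N))"
  proof (rule sum_mono)
    fix e assume "e \<in> E1"
    then have "(1 - x e) * (1 + x e) \<le> (1 - x e) * 2" using x_E1 by (intro mult_left_mono) auto
    then have "1 - (x e)\<^sup>2 \<le> 2 * (1 - x e)" by (simp add: power2_eq_square algebra_simps)
    then show "1 \<le> (x e)\<^sup>2 + 2 * (1 - b e) + 2 * (c / N)" by (simp add: x_def)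
  qed
  also have "\<dots> = (\<Sum>e\<in>E1. (x e)\<^sup>2) + 2 * (\<Sum>e\<in>E1. 1 - b e) + card E1 * (2 * (c / N))"
    by (simp only: sum.distrib sum_distrib_left sum_constant)
  also have "\<dots> \<le> S + 2 * (16 * (S - T)) + 16 * S * (2 * (c / N))"
    using mass deficiency_E1[OF assms] crude cN
    by (intro add_mono mult_left_mono mult_right_mono) auto
  finally show ?thesis by simp
qed

text \<open>The union consists of \<open>round c\<close> stars nested with the heavy ones. Its part
  outside \<open>A\<close> is bounded by the deficiency of heavy stars and the number of extra
  stars; the part of \<open>A\<close> that it misses then follows by comparing sizes, as stars
  overlap little.\<close>

lemma approximation_by_heavy_stars:
  assumes h: "(\<Sum>M\<in>V. (h M)\<^sup>2) \<le> \<epsilon> * c * d1" and N7: "N \<ge> 7"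
    and cN: "c / N \<le> 1 / 10000" and c_half: "c \<ge> 1 / 2" and cN2: "c \<le> (2 * real n - 1) / 2"
    and \<epsilon>: "0 \<le> \<epsilon>" "\<epsilon> \<le> 1 / 100"
  defines "q \<equiv> c\<^sup>2 * (sqrt \<epsilon> + 1 / N)"
  shows "\<exists>\<S>\<subseteq>stars n. int (card \<S>) = round c \<and>
    real (card ((A - \<Union>\<S>) \<union> (\<Union>\<S> - A))) \<le> 30000 * q * d1 \<and> \<bar>c - round c\<bar> \<le> 30000 * q"
proof -
  have n1: "n \<ge> 1" using n_eq by simp
  define m where "m = card E1"
  define r where "r = nat (round c)"
  have r: "int r = round c" using round_nonneg[OF c_nonneg] by (simp add: r_def)
  have rr: "real r = of_int (round c)" using r by (metis of_int_of_nat_eq)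
  have "\<epsilon> * \<epsilon> \<le> \<epsilon> * 1" using \<epsilon> by (intro mult_left_mono) auto
  then have sq: "\<epsilon> \<le> sqrt \<epsilon>" using \<epsilon> by (intro real_le_rsqrt) (simp add: power2_eq_square)
  have qq: "q = c\<^sup>2 * sqrt \<epsilon> + c\<^sup>2 / N" by (simp add: q_def distrib_left)
  have q1: "c\<^sup>2 * \<epsilon> \<le> c\<^sup>2 * sqrt \<epsilon>" using sq by (intro mult_left_mono) auto
  have pos: "0 \<le> c\<^sup>2 * \<epsilon>" "0 \<le> c\<^sup>2 / N" using \<epsilon> N7 by auto
  have cc: "c \<le> 2 * c\<^sup>2" using c_half mult_right_mono[of "1/2" c c] by (simp add: power2_eq_square)
  have c\<epsilon>: "c * \<epsilon> \<le> 2 * (c\<^sup>2 * \<epsilon>)" using mult_right_mono[OF cc \<epsilon>(1)] by simp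
  have cN': "c / N \<le> 2 * (c\<^sup>2 / N)" using divide_right_mono[OF cc, of N] N7 by simp
  have "c \<le> N" using cN2 N7 unfolding N_def by simp
  \<comment> \<open>By \<open>c \<le> 2 * c\<^sup>2\<close> and
    \<open>\<epsilon> \<le> sqrt \<epsilon>\<close> all errors become multiples of \<open>q\<close>.
    With the bound on \<open>S\<close> below, \<open>S - T \<le> 37 * q\<close>.\<close>
  then have T: "c - 34 * q \<le> T"
    using T_lower_simple[OF h N7] c\<epsilon> q1 qq pos by linarith
  have S: "S \<le> c + 3 * q" using S_upper[OF N7] cN' q1 qq pos by linarith
  have T_le_S: "T \<le> S"
  proof -
    have "0 \<le> S - T"
      unfolding S_minus_T by (intro sum_nonneg mult_nonneg_nonneg) (simp_all add: b_le_1)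
    then show ?thesis by simp
  qed
  have "c / N \<le> c" using c_half N7 by (simp add: divide_le_eq)
  then have S': "S \<le> 3 * c" using S_upper[OF N7] c_half by linarith
  have "32 * S * (c / N) \<le> 32 * (3 * c) * (c / N)"
    using S' c_half N7 by (intro mult_right_mono) auto
  then have SN: "32 * S * (c / N) \<le> 96 * (c\<^sup>2 / N)" by (simp add: power2_eq_square)
  \<comment> \<open>\<open>3 + 32 * 37 + 96 = 1283\<close>, from \<open>S\<close>, from
    \<open>S - T\<close> and from the \<open>c / N\<close> term.\<close>
  have m_up: "real m \<le> c + 1300 * q"
    using card_E1_upper cN S T SN pos q1 qq by (simp add: m_def)
  have m_low: "c - 110 * q \<le> real m"
    using card_E1_lower cN S T T_le_S by (simp add: m_def)
  have cr: "\<bar>c - r\<bar> \<le> 1300 * q" and rm: "\<bar>real r - m\<bar> \<le> 2600 * q"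
  proof -
    have half: "\<bar>c - r\<bar> \<le> 1 / 2" using of_int_round_abs_le[of c] rr by (simp add: abs_minus_commute)
    have mc: "\<bar>c - m\<bar> \<le> 1300 * q" using m_up m_low pos q1 qq by linarith
    have "\<bar>c - r\<bar> \<le> 1300 * q \<and> \<bar>real r - m\<bar> \<le> 2600 * q"
    \<comment> \<open>An error below \<open>1 / 2\<close> forces \<open>m\<close> to be the rounding
      of \<open>c\<close>; otherwise the bound already covers the rounding error.\<close>
    proof (cases "1300 * q < 1 / 2")
      case True
      have "round c = int m" using mc True by (intro round_unique') auto
      then have "r = m" using r by simp
      then show ?thesis using mc by simp
    next
      case False
      then show ?thesis using half mc by linarith
    qed
    then show "\<bar>c - r\<bar> \<le> 1300 * q" "\<bar>real r - m\<bar> \<le> 2600 * q" by auto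
  qed
  let ?Y = "star n ` E1"
  have Y: "?Y \<subseteq> stars n" using E1_subset by (auto simp: stars_def K_edges_E)
  have cY: "card ?Y = m"
    unfolding m_def using inj_on_star inj_on_subset[OF _ E1_subset(1)] N7 by (intro card_image) auto
  \<comment> \<open>Nesting ensures that the chosen and the heavy stars differ in exactly as many
    stars as \<open>r\<close> and \<open>m\<close> differ.\<close>
  obtain \<S> where \<S>: "\<S> \<subseteq> stars n" "card \<S> = r" "\<S> \<subseteq> ?Y \<or> ?Y \<subseteq> \<S>"
    using ex_nested_subset_card[OF finite_stars Y] round_le_card_stars[OF n1 c_nonneg cN2]
    unfolding r_def by blast
  have f\<S>: "finite \<S>" using finite_subset[OF \<S>(1) finite_stars] .
  have star_\<S>: "finite X \<and> real (card X) = d1" if X: "X \<in> \<S>" for X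
  proof -
    obtain e where "e \<in> E" "X = star n e"
      using X \<S>(1) unfolding stars_def K_edges_E by blast
    then show ?thesis using card_star finite_star[of n e] by (simp add: star_def perfect_matchings_V)
  qed
  have fB: "finite (\<Union>\<S>)" using f\<S> star_\<S> by auto
  have fA: "finite A" using fin by simp
  have "card (\<Union>\<S> - A) \<le> card (\<Union>X\<in>\<S>. X - A)"
    using f\<S> star_\<S> by (intro card_mono) auto
  also have "\<dots> \<le> (\<Sum>X\<in>\<S>. card (X - A))" using card_UN_le[OF f\<S>] .
  finally have "real (card (\<Union>\<S> - A)) \<le> (\<Sum>X\<in>\<S>. real (card (X - A)))"
    unfolding of_nat_sum[symmetric] of_nat_le_iff .
  \<comment> \<open>Heavy stars leave \<open>A\<close> only by their deficiency. A chosen star that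
    is not heavy may miss \<open>A\<close> altogether, but there are at most \<open>2600 * q\<close>
    of these.\<close>
  also have "\<dots> = (\<Sum>X\<in>\<S> \<inter> ?Y. real (card (X - A))) + (\<Sum>X\<in>\<S> - ?Y. real (card (X - A)))"
    using f\<S> by (rule sum.Int_Diff)
  also have "(\<Sum>X\<in>\<S> \<inter> ?Y. real (card (X - A))) \<le> (\<Sum>X\<in>?Y. real (card (X - A)))"
    using E1_subset by (intro sum_mono2) auto
  also have "\<dots> \<le> (\<Sum>e\<in>E1. real (card (star n e - A)))"
    using sum_image_le[OF E1_subset(2), of "\<lambda>X. real (card (X - A))" "star n"] by (simp add: comp_def)
  also have "\<dots> = d1 * (\<Sum>e\<in>E1. 1 - b e)"
    unfolding sum_distrib_left using E1_subset by (intro sum.cong refl card_star_diff) auto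
  also have "(\<Sum>X\<in>\<S> - ?Y. real (card (X - A))) \<le> (\<Sum>X\<in>\<S> - ?Y. d1)"
  proof (rule sum_mono)
    fix X assume "X \<in> \<S> - ?Y"
    then have X: "finite X" "real (card X) = d1" using star_\<S> by auto
    then have "card (X - A) \<le> card X" by (intro card_mono) auto
    then show "real (card (X - A)) \<le> d1" using X by linarith
  qed
  also have "\<dots> = card (\<S> - ?Y) * d1" by simp
  also have "real (card (\<S> - ?Y)) \<le> 2600 * q"
  proof (cases "\<S> \<subseteq> ?Y")
    case True
    then have "\<S> - ?Y = {}" by auto
    then show ?thesis using pos q1 qq by (simp only: card.empty) simp
  next
    case False
    then have "?Y \<subseteq> \<S>" using \<S>(3) by auto
    then have "card (\<S> - ?Y) = r - m" "m \<le> r"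
      using card_Diff_subset[of ?Y \<S>] card_mono[OF f\<S>, of ?Y] cY \<S>(2) E1_subset by auto
    then show ?thesis using rm by (simp add: of_nat_diff)
  qed
  finally have BA0: "real (card (\<Union>\<S> - A)) \<le> d1 * (\<Sum>e\<in>E1. 1 - b e) + 2600 * q * d1"
    using d_pos by (simp add: mult_right_mono)
  have "(\<Sum>e\<in>E1. 1 - b e) \<le> 16 * (37 * q)"
    using deficiency_E1 cN S T by simp
  then have "d1 * (\<Sum>e\<in>E1. 1 - b e) \<le> d1 * (592 * q)"
    using d_pos by (intro mult_left_mono) auto
  then have BA: "real (card (\<Union>\<S> - A)) \<le> 3192 * (q * d1)"
    using BA0 by (simp add: algebra_simps)
  have B: "r * d1 - r\<^sup>2 * d2 \<le> card (\<Union>\<S>)"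
  proof -
    have "real (card (X \<inter> Y)) \<le> d2" if XY: "X \<in> \<S>" "Y \<in> \<S>" "X \<noteq> Y" for X Y
    proof -
      obtain e f where "e \<in> E" "f \<in> E" "X = star n e" "Y = star n f"
        using XY \<S>(1) unfolding stars_def K_edges_E by blast
      then show ?thesis using card_stars_inter XY(3) by blast
    qed
    then show ?thesis
      using card_Union_lower[OF f\<S> star_\<S>, of d2] d_pos \<S>(2) by simp
  qed
  have overlap: "r\<^sup>2 * d2 \<le> 6 * (q * d1)"
  proof -
    have "real r \<le> 2 * c" using of_int_round_le[of c] rr c_half by linarith
    then have "(real r)\<^sup>2 \<le> (2 * c)\<^sup>2" by (intro power_mono) auto
    then have "r\<^sup>2 * d2 \<le> (2 * c)\<^sup>2 * d2" using d_pos by (intro mult_right_mono) auto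
    also have "\<dots> \<le> 6 * (c\<^sup>2 / N) * d1"
    proof -
      have "4 * N \<le> 6 * (N - 2)" using N7 by simp
      then have "4 * N * (c\<^sup>2 * d2) \<le> 6 * (N - 2) * (c\<^sup>2 * d2)"
        using d_pos by (intro mult_right_mono) auto
      then show ?thesis using N7 by (simp add: d1_d2 field_simps)
    qed
    also have "\<dots> \<le> 6 * q * d1" using pos q1 qq d_pos by (intro mult_right_mono) auto
    finally show ?thesis by simp
  qed
  \<comment> \<open>Counting the union of \<open>A\<close> and the chosen stars in two ways converts
    the bound for one difference into a bound for the other.\<close>
  have "card A + card (\<Union>\<S> - A) = card (A \<union> (\<Union>\<S> - A))"
    using fA fB by (intro card_Un_disjoint[symmetric]) auto
  also have "A \<union> (\<Union>\<S> - A) = \<Union>\<S> \<union> (A - \<Union>\<S>)" by blast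
  also have "card \<dots> = card (\<Union>\<S>) + card (A - \<Union>\<S>)"
    using fA fB by (intro card_Un_disjoint) auto
  finally have "real (card A) + card (\<Union>\<S> - A) = card (\<Union>\<S>) + real (card (A - \<Union>\<S>))"
    by (metis of_nat_add)
  then have "real (card (A - \<Union>\<S>)) \<le> c * d1 + 3192 * (q * d1) - (r * d1 - r\<^sup>2 * d2)"
    using BA B card_A_d1 by linarith
  also have "\<dots> \<le> (c - r) * d1 + 3198 * (q * d1)" using overlap by (simp add: algebra_simps)
  also have "(c - r) * d1 \<le> 1300 * q * d1" using cr d_pos by (intro mult_right_mono) auto
  finally have AB: "real (card (A - \<Union>\<S>)) \<le> 4498 * (q * d1)" by simp
  have "real (card ((A - \<Union>\<S>) \<union> (\<Union>\<S> - A))) \<le> real (card (A - \<Union>\<S>)) + card (\<Union>\<S> - A)"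
    using card_Un_le[of "A - \<Union>\<S>" "\<Union>\<S> - A"] by linarith
  moreover have "0 \<le> q * d1" using pos q1 qq d_pos by (intro mult_nonneg_nonneg) auto
  ultimately have "real (card ((A - \<Union>\<S>) \<union> (\<Union>\<S> - A))) \<le> 30000 * q * d1"
    using AB BA by simp
  moreover have "\<bar>c - round c\<bar> \<le> 30000 * q" using cr rr pos q1 qq by linarith
  ultimately show ?thesis using \<S> r by blast
qed

end

section \<open>The choice between arbitrary and heavy stars\<close>

theorem theorem1p8:
  "\<exists>C0 \<epsilon>0 :: real. C0 > 0 \<and> \<epsilon>0 > 0 \<and>
     (\<forall>(n::nat) (A :: nat set set set) (c::real) (\<epsilon>::real).
        n \<ge> 1 \<and>
        A \<subseteq> perfect_matchings n \<and>
        real (card A) = c * real (odd_dfact (n - 1)) \<and>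
        c \<le> (2 * real n - 1) / 2 \<and>
        0 \<le> \<epsilon> \<and> \<epsilon> \<le> \<epsilon>0 \<and>
        (pm_norm n (indicator A - Proj n (star_span n) (indicator A)))\<^sup>2
          \<le> \<epsilon> * (c / (2 * real n - 1))
        \<longrightarrow>
        (\<exists>B \<S>. \<S> \<subseteq> stars n \<and> int (card \<S>) = round c \<and> B = \<Union>\<S> \<and>
           real (card ((A - B) \<union> (B - A)))
             \<le> C0 * c\<^sup>2 * real (odd_dfact (n - 1)) * (sqrt \<epsilon> + 1 / (2 * real n - 1))) \<and>
        \<bar>c - of_int (round c)\<bar> \<le> C0 * c\<^sup>2 * (sqrt \<epsilon> + 1 / (2 * real n - 1)))"
proof (rule exI[of _ 30000], rule exI[of _ "1 / 100"], intro conjI allI impI; (elim conjE)?)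
  show "(30000 :: real) > 0" "(1 / 100 :: real) > 0" by simp_all
  fix n :: nat and A :: "nat set set set" and c \<epsilon> :: real
  assume n: "n \<ge> 1" and A: "A \<subseteq> perfect_matchings n"
    and cA: "real (card A) = c * real (odd_dfact (n - 1))"
    and c_le: "c \<le> (2 * real n - 1) / 2" and \<epsilon>: "0 \<le> \<epsilon>" "\<epsilon> \<le> 1 / 100"
    and dist: "(pm_norm n (indicator A - Proj n (star_span n) (indicator A)))\<^sup>2
      \<le> \<epsilon> * (c / (2 * real n - 1))"
  define \<beta> where "\<beta> = 30000 * c\<^sup>2 * (sqrt \<epsilon> + 1 / (2 * real n - 1))"
  have c0: "0 \<le> c"
  proof -
    have "0 \<le> c * real (odd_dfact (n - 1))" unfolding cA[symmetric] by simp
    then show ?thesis using odd_dfact_pos[of "n - 1"] by (simp add: zero_le_mult_iff)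
  qed
  have "\<exists>\<S>\<subseteq>stars n. int (card \<S>) = round c \<and>
    real (card ((A - \<Union>\<S>) \<union> (\<Union>\<S> - A))) \<le> \<beta> * odd_dfact (n - 1) \<and> \<bar>c - round c\<bar> \<le> \<beta>"
  \<comment> \<open>Either \<open>\<beta>\<close> is large enough for arbitrary stars, or
    \<open>\<beta> < 3 * c\<close>; dividing by \<open>3 * c\<close> then gives
    \<open>c * (sqrt \<epsilon> + 1 / (2 * n - 1)) < 1 / 10000\<close>.\<close>
  proof (cases "3 * c \<le> \<beta>")
    case True
    then show ?thesis using approximation_by_arbitrary_stars[OF n A cA c0 c_le] by blast
  next
    case False
    then have c: "0 < c" using c0 by (cases "c = 0") (auto simp: \<beta>_def)
    have "c * (30000 * (c * (sqrt \<epsilon> + 1 / (2 * real n - 1)))) < c * 3"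
      using False by (simp add: \<beta>_def power2_eq_square mult_ac)
    then have "30000 * (c * (sqrt \<epsilon> + 1 / (2 * real n - 1))) < 3"
      using c by (simp only: mult_less_cancel_left_pos)
    then have "c * sqrt \<epsilon> + c / (2 * real n - 1) < 1 / 10000"
      by (simp add: distrib_left)
    moreover have "0 \<le> c * sqrt \<epsilon>" using c \<epsilon> by simp
    ultimately have cN: "c / (2 * real n - 1) < 1 / 10000" by linarith
    have "real (card A) > 0" unfolding cA using c odd_dfact_pos[of "n - 1"] by simp
    then have card1: "1 \<le> c * real (odd_dfact (n - 1))" unfolding cA[symmetric] by simp
    \<comment> \<open>A nonempty \<open>A\<close> has \<open>c * odd_dfact (n - 1) \<ge> 1\<close>,
      but for \<open>n \<le> 3\<close> the bound on \<open>c / (2 * n - 1)\<close> makes this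
      product at most \<open>15 / 10000\<close>.\<close>
    have n4: "n \<ge> 4"
    proof (rule ccontr)
      assume "\<not> n \<ge> 4"
      then have "n = 1 \<or> n = 2 \<or> n = 3" using n by auto
      moreover have "odd_dfact 0 = 1" "odd_dfact 1 = 1" "odd_dfact 2 = 3"
        by (simp_all add: odd_dfact_def eval_nat_numeral)
      ultimately show False using cN card1 by (elim disjE) simp_all
    qed
    obtain k where k: "n = Suc (Suc (Suc k))"
      using n4 by (intro that[of "n - 3"]) simp
    interpret matching_family n k A c
      by unfold_locales (fact k A cA)+
    have N: "2 * real n - 1 = N" by (simp add: N_def)
    have N7: "N \<ge> 7" using n4 unfolding N_def by simp
    have d1: "real (odd_dfact (n - 1)) = d1" by (simp add: d1_def k)
    have h: "(\<Sum>M\<in>V. (h M)\<^sup>2) \<le> \<epsilon> * c * d1"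
      using dist N7 d_pos unfolding pm_norm_eq N by (simp add: divide_le_eq mult_ac)
    have cN': "c / N \<le> 1 / 10000" using cN unfolding N by simp
    have \<beta>: "\<beta> = 30000 * (c\<^sup>2 * (sqrt \<epsilon> + 1 / N))"
      unfolding \<beta>_def N by (rule mult.assoc)
    show ?thesis
      using approximation_by_heavy_stars[OF h N7 cN' c_ge_half[OF h N7 cN' c \<epsilon>] c_le \<epsilon>]
      unfolding \<beta> d1 .
  qed
  then obtain \<S> where \<S>: "\<S> \<subseteq> stars n" "int (card \<S>) = round c"
    "real (card ((A - \<Union>\<S>) \<union> (\<Union>\<S> - A))) \<le> \<beta> * odd_dfact (n - 1)"
    and r: "\<bar>c - round c\<bar> \<le> \<beta>" by blast
  have \<beta>_eq: "30000 * c\<^sup>2 * real (odd_dfact (n - 1)) * (sqrt \<epsilon> + 1 / (2 * real n - 1)) =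
      \<beta> * odd_dfact (n - 1)"
    unfolding \<beta>_def by (simp only: mult_ac)
  show "\<exists>B \<S>. \<S> \<subseteq> stars n \<and> int (card \<S>) = round c \<and> B = \<Union>\<S> \<and>
      real (card ((A - B) \<union> (B - A)))
        \<le> 30000 * c\<^sup>2 * real (odd_dfact (n - 1)) * (sqrt \<epsilon> + 1 / (2 * real n - 1))"
    unfolding \<beta>_eq using \<S> by blast
  show "\<bar>c - of_int (round c)\<bar> \<le> 30000 * c\<^sup>2 * (sqrt \<epsilon> + 1 / (2 * real n - 1))"
    using r unfolding \<beta>_def .
qed

end
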